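(* For each positive integer $n$ let $E_n:=\{y\in\mathbb I^n:|y|>\frac n2\}$. Then for every $r\in(2,\infty)$, $$\sup_{n\geqslant 1}\ \sup_{\substack{f\in\mathbb C^{\mathbb I^n}\setminus\{0\}\\ \widehat f(y)=0\text{ for all }y\in E_n}}\frac{\big\|V_r(S_kf:k\in\{0,1,\dots,n\})\big\|_{\ell^2(\mathbb I^n)}}{\big\|f\big\|_{\ell^2(\mathbb I^n)}}<\infty.$$
   Context: For a positive integer $n$, $\mathbb I^n:=\{0,1\}^n$ is the hypercube with the Hamming metric $d(x,y):=|\{j:x(j)\neq y(j)\}|$, and $|x|:=\sum_{j=1}^nx(j)$ for $x\in\mathbb I^n$. For $k\in\{0,1,\dots,n\}$ and $f:\mathbb I^n\to\mathbb C$, the spherical mean is $$S_kf(x):=\frac1{\binom nk}\sum_{y\in\mathbb I^n,\ d(x,y)=k}f(y),\qquad x\in\mathbb I^n.$$ The norm is $\|f\|_{\ell^2(\mathbb I^n)}:=\big(\sum_{x\in\mathbb I^n}|f(x)|^2\big)^{1/2}$. The Fourier transform of $f:\mathbb I^n\to\mathbb C$ is $\widehat f(y):=\frac1{\sqrt{2^n}}\sum_{x\in\mathbb I^n}f(x)(-1)^{x\cdot y}$ for $y\in\mathbb I^n$, where $x\cdot y=\sum_{j=1}^nx(j)y(j)$. For $r\in[1,\infty)$, $Z\subseteq\{0,1,\dots,n\}$ and $x\in\mathbb I^n$, the $r$-variation seminorm is $$V_r(S_kf(x):k\in Z):=\max_{k_0<k_1<\dots<k_J,\ k_j\in Z}\Big(\sum_{j=1}^J|S_{k_{j-1}}f(x)-S_{k_j}f(x)|^r\Big)^{1/r},$$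 the maximum being over all finite nonempty strictly increasing sequences in $Z$. $V_r(S_kf:k\in Z)$ denotes the function $\mathbb I^n\ni x\mapsto V_r(S_kf(x):k\in Z)$. *)

theory Defs
  imports "HOL-Analysis.Analysis"
begin

text \<open>Points of the hypercube are extensional functions on \<open>{1..n}\<close>; a function on the hypercube
  is given by a function on the ambient type, of which only the values on \<open>hypercube n\<close> are ever
  used.\<close>

definition hypercube :: "nat \<Rightarrow> (nat \<Rightarrow> nat) set" where
  "hypercube n = {1..n} \<rightarrow>\<^sub>E {0, 1}"

definition hamming_dist :: "nat \<Rightarrow> (nat \<Rightarrow> nat) \<Rightarrow> (nat \<Rightarrow> nat) \<Rightarrow> nat" where
  "hamming_dist n x y = card {j \<in> {1..n}. x j \<noteq> y j}"

definition weight :: "nat \<Rightarrow> (nat \<Rightarrow> nat) \<Rightarrow> nat" where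
  "weight n x = (\<Sum>j = 1..n. x j)"

definition cube_dot :: "nat \<Rightarrow> (nat \<Rightarrow> nat) \<Rightarrow> (nat \<Rightarrow> nat) \<Rightarrow> nat" where
  "cube_dot n x y = (\<Sum>j = 1..n. x j * y j)"

definition spherical_mean ::
    "nat \<Rightarrow> nat \<Rightarrow> ((nat \<Rightarrow> nat) \<Rightarrow> complex) \<Rightarrow> (nat \<Rightarrow> nat) \<Rightarrow> complex" where
  "spherical_mean n k f x =
     1 / of_nat (n choose k) * (\<Sum>y | y \<in> hypercube n \<and> hamming_dist n x y = k. f y)"

definition cube_fourier ::
    "nat \<Rightarrow> ((nat \<Rightarrow> nat) \<Rightarrow> complex) \<Rightarrow> (nat \<Rightarrow> nat) \<Rightarrow> complex" where
  "cube_fourier n f y =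
     1 / complex_of_real (sqrt (2 ^ n)) * (\<Sum>x\<in>hypercube n. f x * (-1) ^ cube_dot n x y)"

definition l2_norm :: "nat \<Rightarrow> ((nat \<Rightarrow> nat) \<Rightarrow> 'a::real_normed_vector) \<Rightarrow> real" where
  "l2_norm n f = L2_set (\<lambda>x. norm (f x)) (hypercube n)"

text \<open>The list \<open>ks\<close> is the sequence \<open>k\<^sub>0 < \<dots> < k\<^sub>J\<close>, so that \<open>J = length ks - 1\<close>. The variation
  is meaningful for finite nonempty \<open>Z\<close>, where the maximum exists.\<close>

definition increasing_seqs :: "nat set \<Rightarrow> nat list set" where
  "increasing_seqs Z = {ks. ks \<noteq> [] \<and> sorted_wrt (<) ks \<and> set ks \<subseteq> Z}"

definition variation :: "real \<Rightarrow> nat set \<Rightarrow> (nat \<Rightarrow> complex) \<Rightarrow> real" where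
  "variation r Z a = Max ((\<lambda>ks.
     (\<Sum>j = 1..length ks - 1. norm (a (ks ! (j - 1)) - a (ks ! j)) powr r) powr (1 / r))
       ` increasing_seqs Z)"

lemma finite_increasing_seqs:
  assumes "finite Z"
  shows "finite (increasing_seqs Z)"
proof (rule finite_subset)
  show "increasing_seqs Z \<subseteq> {ks. set ks \<subseteq> Z \<and> distinct ks}"
    by (auto simp: increasing_seqs_def strict_sorted_iff)
  show "finite {ks. set ks \<subseteq> Z \<and> distinct ks}"
    using assms by (rule finite_subset_distinct)
qed

lemma increasing_seqs_nonempty:
  assumes "k \<in> Z"
  shows "[k] \<in> increasing_seqs Z"
  using assms by (simp add: increasing_seqs_def)

definition high_freqs :: "nat \<Rightarrow> (nat \<Rightarrow> nat) set" where
  "high_freqs n = {y \<in> hypercube n. real (weight n y) > real n / 2}"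

end

theory Submission
  imports Defs
begin

text \<open>On functions with spectrum in \<open>|y| \<le> n/2\<close>, the antipodal map turns \<open>S\<^sub>n\<^sub>-\<^sub>k\<close> into \<open>S\<^sub>k\<close>, so only
  \<open>k \<le> n/2\<close> matters. There \<open>S\<^sub>k\<close> is compared with the multiplier \<open>(1 - k/n)\<^bsup>|y|\<^esup>\<close>. The latter is
  the average, over random labels \<open>\<omega> : {1..n} \<rightarrow> {0..<n}\<close>, of the conditional expectations onto the
  coordinates with label at least \<open>k\<close>; for fixed \<open>\<omega>\<close> these form a reverse martingale in \<open>k\<close>, and
  Lepingle's inequality in \<open>L\<^sup>2\<close> applies. The difference is handled by a square function:
  the Krawtchouk multiplier \<open>\<kappa>\<^sub>k(j)\<close> of \<open>S\<^sub>k\<close> satisfies \<open>|\<kappa>\<^sub>k(j)| \<le> exp (- jk/5n)\<close> for \<open>j, k \<le> n/2\<close>,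
  its increment in \<open>k\<close> is \<open>2j/n\<close> times a Krawtchouk multiplier in dimension \<open>n - 1\<close>, and a sequence
  \<open>a\<close> has 2-variation at most a multiple of
  \<open>(\<Sum>k. |a\<^sub>k|\<^sup>2 / (k + 1) + (k + 1) |a\<^sub>k\<^sub>+\<^sub>1 - a\<^sub>k|\<^sup>2)\<^bsup>1/2\<^esup>\<close>.\<close>

section \<open>Krawtchouk multipliers\<close>

text \<open>A restriction on the spectrum is unavoidable: at |y| = n the multiplier of S_k is
  (-1)^k, so the variation of a single character already grows like n^(1/r). For |y| \<le> n/2 such
  a sign survives only as the factor (-1)^|y| relating the radii n - k and k, which the antipodal
  map absorbs. The comparison multiplier need not be close to that of S_k: it suffices that both
  equal 1 at k = 0 and decay like exp (- c s k) with s = |y|/n. Up to constants the difference is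
  then at most the smaller of s k and exp (- c s k), its increments gain a factor s, and the
  weighted square sum, being invariant under rescaling of k, is bounded uniformly in s and n. The
  martingale part is dimension-free because the bound for each labelling has the same constant and
  averaging costs nothing. All L^2 estimates hold along sampling sequences that depend arbitrarily
  on the point, so maximising sequences may be inserted at the end. The strict inequality r > 2
  makes the geometric series over dyadic jump sizes, of ratio (1/2)^(r-2), converge.\<close>

definition kraw_poly :: "nat \<Rightarrow> nat \<Rightarrow> real poly" where
  "kraw_poly n j = [:1, -1:] ^ j * [:1, 1:] ^ (n - j)"

text \<open>The coefficient of z^k in (1 - z)^j (1 + z)^(n - j) is the Krawtchouk polynomial K_k(j).
  Dividing by the binomial normalises it to 1 at \<open>j = 0\<close>; the quotient is the
  eigenvalue of S_k on characters of weight \<open>j\<close>, see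
  \<open>spherical_mean_mult\<close>.\<close>

definition kraw :: "nat \<Rightarrow> nat \<Rightarrow> nat \<Rightarrow> real" where
  "kraw n k j = coeff (kraw_poly n j) k / real (n choose k)"

lemma pderiv_kraw_poly:
  assumes "1 \<le> j" "2 * j \<le> n"
  shows "pderiv (kraw_poly n j) =
    smult (real n - 2 * real j) (kraw_poly (n - 1) j)
    - smult (2 * real j) (pCons 0 (kraw_poly (n - 2) (j - 1)))"
proof -
  obtain i where i: "j = Suc i" using assms by (cases j) auto
  obtain a where a: "n = j + Suc a"
    using assms by (intro that[of "n - j - 1"]) simp
  define P Q where "P = [:1, -1 :: real:] ^ i" and "Q = [:1, 1 :: real:] ^ a"
  define z where "z = [:0, 1 :: real:]"
  have X: "[:1, -1 :: real:] = 1 - z" and Y: "[:1, 1 :: real:] = 1 + z"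
    by (simp_all add: z_def one_pCons)
  have dX: "pderiv (1 - z) = -1" and dY: "pderiv (1 + z) = 1"
    by (simp_all add: z_def pderiv_diff pderiv_add pderiv_pCons one_pCons)
  have 1: "kraw_poly n j = [:1, -1:] ^ Suc i * [:1, 1:] ^ Suc a"
    by (simp add: kraw_poly_def i a)
  have 2: "kraw_poly (n - 1) j = (1 - z) * P * Q" "kraw_poly (n - 2) (j - 1) = P * Q"
    by (simp_all add: kraw_poly_def i a P_def Q_def X)
  have sm: "smult (real k) p = of_nat k * p" for k p
    by (simp add: of_nat_poly)
  have pc: "pCons 0 p = z * p" for p by (simp add: z_def)
  have c: "real n - 2 * real j = real a - real i" by (simp add: i a)
  have "pderiv (kraw_poly n j) =
      (1 - z) * P * (of_nat (Suc a) * Q) - of_nat (Suc i) * P * ((1 + z) * Q)"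
    unfolding 1 pderiv_mult pderiv_power_Suc sm
    by (simp add: P_def Q_def X Y dX dY algebra_simps)
  \<comment> \<open>In the second term 1 + z = (1 - z) + 2 z, which leaves the coefficients
    \<open>a - i\<close> and \<open>2 * j\<close>.\<close>
  also have "\<dots> = (of_nat a - of_nat i) * ((1 - z) * P * Q) - of_nat (2 * j) * (z * (P * Q))"
    by (simp add: i algebra_simps)
  also have "\<dots> = smult (real n - 2 * real j) (kraw_poly (n - 1) j)
    - smult (real (2 * j)) (pCons 0 (kraw_poly (n - 2) (j - 1)))"
    unfolding c 2 smult_diff_left sm pc by (simp add: algebra_simps)
  finally show ?thesis by simp
qed

lemma coeff_kraw_poly_0: "coeff (kraw_poly n j) 0 = 1"
  by (simp add: kraw_poly_def coeff_0_power coeff_mult)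

lemma kraw_0_right [simp]: "k \<le> n \<Longrightarrow> kraw n k 0 = 1"
proof -
  assume "k \<le> n"
  have "coeff ([:1, 1:] ^ n) k = real (n choose k)"
    using coeff_linear_poly_power[of k n 1 "1 :: real"] \<open>k \<le> n\<close> by simp
  then show ?thesis using \<open>k \<le> n\<close> by (simp add: kraw_def kraw_poly_def)
qed

lemma kraw_0_left [simp]: "kraw n 0 j = 1"
  by (simp add: kraw_def coeff_kraw_poly_0)

text \<open>Writing the generating polynomial as \<open>(1 - z\<^sup>2)\<^sup>j (1 + z)\<^bsup>n - 2j\<^esup>\<close> and differentiating gives a
  recursion that remains in the range \<open>2 j \<le> n\<close>, \<open>2 k \<le> n\<close> and whose coefficients are small enough
  for an inductive proof of exponential decay.\<close>

lemma kraw_rec: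
  assumes "1 \<le> j" "2 * j \<le> n" "1 \<le> k" "2 * k \<le> n"
  shows "kraw n k j = (1 - 2 * real j / n) * kraw (n - 1) (k - 1) j
    - (2 * real j / n) * ((real k - 1) / (real n - 1)) * kraw (n - 2) (k - 2) (j - 1)"
proof -
  obtain k' where k': "k = Suc k'" using assms by (cases k) auto
  have n2: "2 \<le> n" using assms by simp
  obtain m where m: "n = Suc (Suc m)" using n2 by (metis Suc_le_D numeral_2_eq_2 Suc_le_mono)
  have eq: "real k * coeff (kraw_poly n j) k = (real n - 2 * real j) * coeff (kraw_poly (n - 1) j) k'
     - 2 * real j * coeff (pCons 0 (kraw_poly (n - 2) (j - 1))) k'"
    using arg_cong[OF pderiv_kraw_poly[OF assms(1,2)], of "\<lambda>p. coeff p k'"]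
    by (simp only: coeff_pderiv coeff_diff coeff_smult k')
  have b1: "real k * real (n choose k) = real n * real ((n - 1) choose k')"
    using Suc_times_binomial_eq[of "Suc m" k'] unfolding k' m
    by (metis diff_Suc_1 mult.commute of_nat_mult)
  have pos: "real (n choose k) > 0" "real ((n - 1) choose k') > 0"
    using assms k' by (auto simp: zero_less_binomial_iff)
  have c1: "coeff (kraw_poly (n - 1) j) k' = kraw (n - 1) (k - 1) j * real ((n - 1) choose k')"
    using pos by (simp add: kraw_def k')
  have c2: "(real n - 1) * coeff (pCons 0 (kraw_poly (n - 2) (j - 1))) k' =
     (real k - 1) * kraw (n - 2) (k - 2) (j - 1) * real ((n - 1) choose k')"
  \<comment> \<open>For \<open>k = 1\<close> the truncated \<open>k - 2\<close> is a wrong index,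
    harmless because the factor \<open>k - 1\<close> is 0.\<close>
  proof (cases k')
    case 0
    then show ?thesis by (simp add: k')
  next
    case (Suc k'')
    have "real k' * real ((n - 1) choose k') = real (n - 1) * real ((n - 2) choose k'')"
    proof -
      have "real (Suc k'') * real (Suc m choose Suc k'') = real (Suc m) * real (m choose k'')"
        unfolding of_nat_mult[symmetric] Suc_times_binomial_eq by (simp only: mult.commute)
      then show ?thesis by (simp only: m Suc diff_Suc_1 diff_Suc_Suc numeral_2_eq_2 diff_zero)
    qed
    have D: "real ((n - 2) choose k'') > 0"
      using assms k' Suc by (auto simp: zero_less_binomial_iff)
    have kk: "k - 2 = k''" "real k - 1 = real k'" "real n - 1 = real (n - 1)"
      using k' Suc n2 by auto
    have "kraw (n - 2) (k - 2) (j - 1) * real ((n - 2) choose k'')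
       = coeff (kraw_poly (n - 2) (j - 1)) k''" using D unfolding kk(1) kraw_def by simp
    moreover have "coeff (pCons 0 (kraw_poly (n - 2) (j - 1))) k'
       = coeff (kraw_poly (n - 2) (j - 1)) k''" by (simp add: Suc)
    ultimately have "(real n - 1) * coeff (pCons 0 (kraw_poly (n - 2) (j - 1))) k'
       = kraw (n - 2) (k - 2) (j - 1) * (real (n - 1) * real ((n - 2) choose k''))"
      by (simp only: kk mult_ac)
    also have "real (n - 1) * real ((n - 2) choose k'') = real k' * real ((n - 1) choose k')"
      using \<open>real k' * real ((n - 1) choose k') = _\<close> by (rule sym)
    finally show ?thesis by (simp only: kk mult_ac)
  qed
  have dist1: "x * (a * u - b * v) = a * x * u - b * (x * v)" for x a u b v :: real
    by (simp add: algebra_simps)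
  have dist2: "(x * (n * c) * n1 = a * (u * c) - b * (d * v * c)) \<longleftrightarrow>
      (x * n * n1 * c = (a * u - b * (d * v)) * c)" for x n c n1 a u b d v :: real
    by (simp add: algebra_simps)
  have "kraw n k j * (real n * real ((n - 1) choose k')) * (real n - 1) =
      (real n - 1) * (kraw n k j * (real k * real (n choose k)))"
    unfolding b1 by (simp only: mult_ac)
  also have "kraw n k j * (real k * real (n choose k)) = real k * coeff (kraw_poly n j) k"
    using pos by (simp add: kraw_def)
  also note eq
  finally have "kraw n k j * (real n * real ((n - 1) choose k')) * (real n - 1) =
     (real n - 2 * real j) * (real n - 1) * coeff (kraw_poly (n - 1) j) k'
     - 2 * real j * ((real n - 1) * coeff (pCons 0 (kraw_poly (n - 2) (j - 1))) k')"
    by (simp only: dist1)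
  then have "(kraw n k j * real n * (real n - 1)) * real ((n - 1) choose k') =
     ((real n - 2 * real j) * (real n - 1) * kraw (n - 1) (k - 1) j
     - 2 * real j * ((real k - 1) * kraw (n - 2) (k - 2) (j - 1))) * real ((n - 1) choose k')"
    unfolding c1 c2 by (simp only: dist2)
  then have *: "kraw n k j * real n * (real n - 1) =
     (real n - 2 * real j) * (real n - 1) * kraw (n - 1) (k - 1) j
     - 2 * real j * ((real k - 1) * kraw (n - 2) (k - 2) (j - 1))"
    using pos(2) by simp
  have "real n > 0" "real n - 1 > 0" using n2 by auto
  then have "real n * (real n - 1) \<noteq> 0" by simp
  then have "kraw n k j = ((real n - 2 * real j) * (real n - 1) * kraw (n - 1) (k - 1) j
     - 2 * real j * ((real k - 1) * kraw (n - 2) (k - 2) (j - 1))) / (real n * (real n - 1))"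
    using * by (subst nonzero_eq_divide_eq) (auto simp only: mult.assoc)
  also have "\<dots> = (1 - 2 * real j / n) * kraw (n - 1) (k - 1) j
    - (2 * real j / n) * ((real k - 1) / (real n - 1)) * kraw (n - 2) (k - 2) (j - 1)"
  proof -
    have "((a - 2 * b) * d * x - 2 * b * (c * y)) / (a * d) = (1 - 2 * b / a) * x - 2 * b / a * (c / d) * y"
      if "a > 0" "d > 0" for a b c d x y :: real
      using that by (simp add: field_simps)
    then show ?thesis using \<open>real n > 0\<close> \<open>real n - 1 > 0\<close> by blast
  qed
  finally show ?thesis .
qed

text \<open>Strong induction with \<open>kraw_rec\<close>. With x = j/n the weights of the two terms
  are 1 - 2x and at most x, because (k - 1)/(n - 1) \<le> 1/2; their sum 1 - x leaves room for the
  loss in the exponent. That loss is a factor exp (x/5) \<le> 1 + 2x/5 in the first term and exp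
  (2/5) \<le> 1.56 in the second, and (1 - 2x)(1 + 2x/5) + 1.56 x \<le> 1. The rate 1/5 is small
  enough for this to close.\<close>

lemma kraw_exp_bound:
  assumes "2 * j \<le> n" "2 * k \<le> n"
  shows "\<bar>kraw n k j\<bar> \<le> exp (- (real j * real k / (5 * real n)))"
  using assms
proof (induction n arbitrary: j k rule: less_induct)
  case (less n)
  show ?case
  proof (cases "j = 0 \<or> k = 0")
    case True
    then show ?thesis using less.prems by auto
  next
    case False
    then have jk: "1 \<le> j" "1 \<le> k" by auto
    then have n2: "2 \<le> n" using less.prems by simp
    define x where "x = real j / n"
    define E where "E = exp (- (real j * real k / (5 * real n)))"
    have E: "E > 0" by (simp add: E_def)
    have x: "0 \<le> x" "2 * x \<le> 1" using less.prems n2 by (auto simp: x_def field_simps)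
    have t1: "(1 - 2 * x) * \<bar>kraw (n - 1) (k - 1) j\<bar> \<le> (1 - 2 * x) * (E * (1 + 2 * (x / 5)))"
    \<comment> \<open>For \<open>2 * j = n\<close> the pair (n - 1, j) leaves the range of the
      induction hypothesis, but then its weight 1 - 2x vanishes.\<close>
    proof (cases "2 * j = n")
      case True
      then have "real n = 2 * real j" by simp
      then have "2 * x = 1" using n2 jk by (simp add: x_def)
      then show ?thesis by simp
    next
      case False
      have "\<bar>kraw (n - 1) (k - 1) j\<bar> \<le> exp (- (real j * real (k - 1) / (5 * real (n - 1))))"
        using False less.prems n2 jk by (intro less.IH) auto
      also have "\<dots> \<le> exp (- (real j * real k / (5 * real n)) + x / 5)"
      proof -
        have "real j * real k / n - x \<le> real j * (real (k - 1) / real (n - 1))"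
        proof -
          have "real k / n - 1 / n \<le> real (k - 1) / real (n - 1)"
            using n2 jk by (simp add: field_simps of_nat_diff)
          from mult_left_mono[OF this, of "real j"] show ?thesis
            by (simp add: x_def algebra_simps)
        qed
        then show ?thesis by (simp add: field_simps)
      qed
      also have "\<dots> = E * exp (x / 5)" by (simp add: E_def mult_exp_exp)
      also have "exp (x / 5) \<le> 1 + 2 * (x / 5)"
      proof -
        have "exp (x / 5) \<le> 1 + x / 5 + (x / 5)\<^sup>2" using x by (intro exp_bound) auto
        also have "(x / 5)\<^sup>2 \<le> x / 5" using x mult_left_le[of "x / 5" "x / 5"] by (simp add: power2_eq_square)
        finally show ?thesis by simp
      qed
      finally show ?thesis using E x by (intro mult_left_mono) auto
    qed
    have t2: "(2 * x) * ((real k - 1) / (real n - 1)) * \<bar>kraw (n - 2) (k - 2) (j - 1)\<bar>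
        \<le> x * (156 / 100 * E)"
    proof (cases "k = 1")
      case True
      then show ?thesis using E x by simp
    next
      case False
      then have k2: "2 \<le> k" using jk by simp
      then have n4: "4 \<le> n" using less.prems by simp
      have "\<bar>kraw (n - 2) (k - 2) (j - 1)\<bar> \<le> exp (- (real (j - 1) * real (k - 2) / (5 * real (n - 2))))"
        using less.prems n2 jk k2 by (intro less.IH) auto
      also have "\<dots> \<le> exp (- (real j * real k / (5 * real n)) + 4 / 10)"
      proof -
        \<comment> \<open>Since j k - (j - 1) (k - 2) = 2 j + k - 2 \<le> 2 n.\<close>
        have "real j * real k / n - 2 \<le> real (j - 1) * real (k - 2) / n"
        proof -
          have "real j * real k - 2 * n \<le> real (j - 1) * real (k - 2)"
            using jk k2 less.prems by (simp add: of_nat_diff algebra_simps)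
          from divide_right_mono[OF this, of "real n"] show ?thesis
            using n2 by (simp add: diff_divide_distrib)
        qed
        also have "\<dots> \<le> real (j - 1) * real (k - 2) / real (n - 2)"
          using n4 by (intro divide_left_mono) auto
        finally show ?thesis by (simp add: field_simps)
      qed
      also have "\<dots> = E * exp (4 / 10)" by (simp add: E_def mult_exp_exp)
      also have "exp (4 / 10) \<le> (156 / 100 :: real)"
        using exp_bound[of "4 / 10"] by (simp add: power2_eq_square)
      finally have 1: "\<bar>kraw (n - 2) (k - 2) (j - 1)\<bar> \<le> E * (156 / 100)" using E by simp
      have 2: "(real k - 1) / (real n - 1) \<le> 1 / 2" "0 \<le> (real k - 1) / (real n - 1)"
        using n4 k2 less.prems by (auto simp: field_simps)
      have "(2 * x) * ((real k - 1) / (real n - 1)) * \<bar>kraw (n - 2) (k - 2) (j - 1)\<bar>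
        \<le> (2 * x) * (1 / 2) * (E * (156 / 100))"
        using x 1 2 E by (intro mult_mono mult_left_mono) auto
      then show ?thesis by simp
    qed
    have "\<bar>kraw n k j\<bar> \<le> (1 - 2 * x) * \<bar>kraw (n - 1) (k - 1) j\<bar>
       + (2 * x) * ((real k - 1) / (real n - 1)) * \<bar>kraw (n - 2) (k - 2) (j - 1)\<bar>"
    proof -
      have "0 \<le> (2 * x) * ((real k - 1) / (real n - 1))" using x jk n2 by simp
      moreover have "0 \<le> 1 - 2 * x" using x by simp
      moreover have "kraw n k j = (1 - 2 * x) * kraw (n - 1) (k - 1) j
         - (2 * x) * ((real k - 1) / (real n - 1)) * kraw (n - 2) (k - 2) (j - 1)"
        using kraw_rec[OF jk(1) less.prems(1) jk(2) less.prems(2)] by (simp add: x_def)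
      ultimately show ?thesis
        by (metis abs_mult abs_of_nonneg abs_triangle_ineq4)
    qed
    also have "\<dots> \<le> (1 - 2 * x) * (E * (1 + 2 * (x / 5))) + x * (156 / 100 * E)"
      using t1 t2 by (rule add_mono)
    also have "\<dots> = E * (1 - x * (4 / 100) - 4 / 5 * (x * x))" by (simp add: field_simps)
    also have "\<dots> \<le> E * 1"
    proof -
      have "1 - x * (4 / 100) - 4 / 5 * (x * x) \<le> 1" using x zero_le_square[of x] by linarith
      then show ?thesis using E by (intro mult_left_mono) auto
    qed
    finally show ?thesis by (simp add: E_def)
  qed
qed

text \<open>The k-th coefficient of n F - (1 + z) F', for the generating polynomial F, is (n - k)
  F_k - (k + 1) F_(k+1), and absorption turns both binomial weights into n times
  \<open>(n - 1) choose k\<close>. On the other hand n F - (1 + z) F' = 2 j (1 - z)^(j - 1) (1 +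
  z)^(n - j), which is 2 j times the generating polynomial of (n - 1, j - 1).\<close>

lemma kraw_diff:
  assumes "1 \<le> j" "j \<le> n" "k < n"
  shows "kraw n k j - kraw n (Suc k) j = 2 * real j / n * kraw (n - 1) k (j - 1)"
proof -
  obtain i where i: "j = Suc i" using assms by (cases j) auto
  define a where "a = n - j"
  have n: "n = Suc i + a" using assms by (simp add: a_def i)
  define P where "P = [:1, -1 :: real:] ^ i"
  define z where "z = [:0, 1 :: real:]"
  have X: "[:1, -1 :: real:] = 1 - z" and Y: "[:1, 1 :: real:] = 1 + z"
    by (simp_all add: z_def one_pCons)
  have dX: "pderiv (1 - z) = -1" and dY: "pderiv (1 + z) = 1"
    by (simp_all add: z_def pderiv_diff pderiv_add pderiv_pCons one_pCons)
  have sm: "smult (real k) p = of_nat k * p" for k p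
    by (simp add: of_nat_poly)
  have pc: "pCons 0 p = z * p" for p by (simp add: z_def)
  have F: "kraw_poly n j = (1 - z) ^ Suc i * (1 + z) ^ a"
    by (simp add: kraw_poly_def X Y n i)
  have G: "kraw_poly (n - 1) (j - 1) = P * (1 + z) ^ a"
    by (simp add: kraw_poly_def X Y n i P_def)
  have da: "(1 + z) * pderiv ((1 + z) ^ a) = of_nat a * (1 + z) ^ a"
  proof (cases a)
    case (Suc b)
    then show ?thesis unfolding Suc pderiv_power_Suc sm dY by (simp add: algebra_simps)
  qed simp
  have dF: "(1 + z) * pderiv (kraw_poly n j) =
     (1 - z) * P * (of_nat a * (1 + z) ^ a) - (1 + z) * (1 + z) ^ a * (of_nat (Suc i) * P)"
  proof -
    have "(1 + z) * pderiv (kraw_poly n j) =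
      (1 - z) ^ Suc i * ((1 + z) * pderiv ((1 + z) ^ a))
      + (1 + z) * (1 + z) ^ a * pderiv ((1 - z) ^ Suc i)"
      unfolding F pderiv_mult by (simp only: algebra_simps)
    also have "\<dots> = (1 - z) * P * (of_nat a * (1 + z) ^ a)
        - (1 + z) * (1 + z) ^ a * (of_nat (Suc i) * P)"
      unfolding da pderiv_power_Suc sm dX by (simp add: P_def X)
    finally show ?thesis .
  qed
  have "smult (real n) (kraw_poly n j) - pCons 0 (pderiv (kraw_poly n j)) - pderiv (kraw_poly n j)
      = of_nat n * kraw_poly n j - (1 + z) * pderiv (kraw_poly n j)"
    unfolding sm pc by (simp add: algebra_simps)
  also have "\<dots> = smult (real (2 * j)) (kraw_poly (n - 1) (j - 1))"
    unfolding dF unfolding F sm G by (simp add: n i P_def X algebra_simps del: mult_pCons_left mult_pCons_right)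
  finally have "coeff (smult (real n) (kraw_poly n j) - pCons 0 (pderiv (kraw_poly n j))
       - pderiv (kraw_poly n j)) k = coeff (smult (real (2 * j)) (kraw_poly (n - 1) (j - 1))) k"
    by simp
  moreover have "coeff (pCons 0 (pderiv (kraw_poly n j))) k = real k * coeff (kraw_poly n j) k"
    by (cases k) (simp_all add: coeff_pderiv)
  ultimately have eq: "(real n - real k) * coeff (kraw_poly n j) k
      - real (Suc k) * coeff (kraw_poly n j) (Suc k) = 2 * real j * coeff (kraw_poly (n - 1) (j - 1)) k"
    by (simp add: coeff_pderiv algebra_simps)
  obtain m where m: "n = Suc m" using n by simp
  have pos: "real (n choose k) > 0" "real (n choose Suc k) > 0" "real ((n - 1) choose k) > 0"
    using assms by (simp_all only: of_nat_0_less_iff zero_less_binomial_iff)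
  have b1: "real (Suc k) * real (n choose Suc k) = (real n - real k) * real (n choose k)"
    using binomial_absorb_comp[of n k] binomial_absorption[of k n] assms
    by (metis less_imp_le of_nat_diff of_nat_mult)
  have b2: "(real n - real k) * real (n choose k) = real n * real ((n - 1) choose k)"
    using binomial_absorb_comp[of n k] assms by (metis less_imp_le of_nat_diff of_nat_mult)
  have nk: "real n - real k > 0" using assms by simp
  have "real n * real ((n - 1) choose k) * (kraw n k j - kraw n (Suc k) j)
     = (real n - real k) * real (n choose k) * kraw n k j
       - real (Suc k) * real (n choose Suc k) * kraw n (Suc k) j"
    unfolding b1 b2 by (simp only: algebra_simps)
  also have "\<dots> = (real n - real k) * coeff (kraw_poly n j) k
      - real (Suc k) * coeff (kraw_poly n j) (Suc k)"
    using pos by (simp add: kraw_def)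
  also have "\<dots> = 2 * real j * (real ((n - 1) choose k) * kraw (n - 1) k (j - 1))"
    unfolding eq using pos by (simp add: kraw_def)
  finally have "real ((n - 1) choose k) * (real n * (kraw n k j - kraw n (Suc k) j))
     = real ((n - 1) choose k) * (2 * real j * kraw (n - 1) k (j - 1))"
    by (simp only: mult_ac)
  then have "real n * (kraw n k j - kraw n (Suc k) j) = 2 * real j * kraw (n - 1) k (j - 1)"
    using pos(3) by simp
  moreover have "real n > 0" using assms by simp
  ultimately show ?thesis by (simp add: field_simps)
qed

section \<open>Difference between the Krawtchouk multiplier and the power multiplier\<close>

lemma power_diff_le:
  fixes a b :: real
  assumes "0 \<le> b" "b \<le> a"
  shows "a ^ j - b ^ j \<le> real j * (a - b) * a ^ (j - 1)"
proof (induction j)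
  case (Suc j)
  have "a ^ Suc j - b ^ Suc j = a * (a ^ j - b ^ j) + (a - b) * b ^ j"
    by (simp add: algebra_simps)
  also have "\<dots> \<le> a * (real j * (a - b) * a ^ (j - 1)) + (a - b) * a ^ j"
    using Suc assms by (intro add_mono mult_left_mono power_mono) auto
  also have "\<dots> = real (Suc j) * (a - b) * a ^ (Suc j - 1)"
    by (cases j) (simp_all add: algebra_simps)
  finally show ?case .
qed simp

lemma sum_Suc_mult_power_le:
  fixes q :: real
  assumes "0 \<le> q" "q < 1"
  shows "(\<Sum>k<h. real (Suc k) * q ^ k) \<le> 1 / (1 - q)\<^sup>2"
proof -
  have "(1 - q)\<^sup>2 * (\<Sum>k<h. real (Suc k) * q ^ k) = 1 - real (Suc h) * q ^ h + real h * q ^ Suc h"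
    by (induction h) (simp_all add: algebra_simps power2_eq_square)
  also have "\<dots> \<le> 1 - real (Suc h) * q ^ h + real (Suc h) * q ^ h"
    using assms by (intro add_left_mono mult_mono power_decreasing) auto
  finally show ?thesis using assms by (simp add: field_simps)
qed

text \<open>The multiplier of \<open>S\<^sub>k\<close> minus that of the averaged martingale.\<close>

definition mult_diff :: "nat \<Rightarrow> nat \<Rightarrow> nat \<Rightarrow> real" where
  "mult_diff n k j = kraw n k j - (1 - real k / n) ^ j"

text \<open>With s = j/n, the Krawtchouk increment is 2 s times a multiplier in dimension n - 1, and
  the power increment is at most s (1 - k/n)^(j - 1). Replacing j - 1 by j costs at most k/n \<le>
  1/2 in the exponent, a factor exp (1/2) \<le> 2; hence 6 = 4 + 2.\<close>

lemma mult_diff_step: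
  assumes "1 \<le> j" "2 * j \<le> n" "2 * Suc k \<le> n"
  shows "\<bar>mult_diff n (Suc k) j - mult_diff n k j\<bar>
    \<le> 6 * (real j / n) * exp (- (real j / n * k / 5))"
proof -
  have n2: "n \<ge> 2" using assms by simp
  define s where "s = real j / n"
  have s: "s \<ge> 0" by (simp add: s_def)
  have kn: "2 * real k \<le> n" using assms(3) by simp
  have low: "s * k - 1 / 2 \<le> real (j - 1) * k / n"
    using n2 assms kn by (simp add: s_def field_simps of_nat_diff)
  have low': "real (j - 1) * k / n \<le> real (j - 1) * k / real (n - 1)"
    using n2 by (intro divide_left_mono) auto
  have "\<bar>kraw n k j - kraw n (Suc k) j\<bar> = 2 * s * \<bar>kraw (n - 1) k (j - 1)\<bar>"
    using assms n2 by (subst kraw_diff) (auto simp: abs_mult s_def)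
  also have "\<bar>kraw (n - 1) k (j - 1)\<bar> \<le> exp (- (real (j - 1) * real k / (5 * real (n - 1))))"
    using assms by (intro kraw_exp_bound) auto
  also have "\<dots> \<le> exp (1 / 2 + - (s * k / 5))"
    using low low' by simp
  also have "\<dots> = exp (1 / 2) * exp (- (s * k / 5))" by (rule exp_add)
  also have "exp (1 / 2) \<le> (2 :: real)"
    using exp_bound[of "1 / 2"] by (simp add: power2_eq_square)
  finally have 1: "\<bar>kraw n k j - kraw n (Suc k) j\<bar> \<le> 4 * s * exp (- (s * k / 5))"
    using s by (simp add: mult_left_mono)
  have a: "0 \<le> 1 - real (Suc k) / n" "1 - real (Suc k) / n \<le> 1 - real k / n"
    "(1 - real k / n) - (1 - real (Suc k) / n) = 1 / n"
    using assms n2 by (auto simp: field_simps)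
  have "\<bar>(1 - real k / n) ^ j - (1 - real (Suc k) / n) ^ j\<bar>
     = (1 - real k / n) ^ j - (1 - real (Suc k) / n) ^ j"
    using a by (simp add: power_mono)
  also have "\<dots> \<le> real j * (1 / n) * (1 - real k / n) ^ (j - 1)"
    using power_diff_le[OF a(1,2), of j] unfolding a(3) .
  also have "\<dots> \<le> s * exp (- (real k / n)) ^ (j - 1)"
    using a exp_ge_add_one_self[of "- (real k / n)"] s
    by (simp add: s_def) (intro mult_left_mono divide_right_mono power_mono, auto)
  also have "exp (- (real k / n)) ^ (j - 1) = exp (- (real (j - 1) * k / n))"
    by (simp add: exp_of_nat_mult[symmetric])
  also have "\<dots> \<le> exp (1 / 2 + - (s * k / 5))"
  proof -
    have "0 \<le> s * k" using s by simp
    then show ?thesis using low by simp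
  qed
  also have "\<dots> = exp (1 / 2) * exp (- (s * k / 5))" by (rule exp_add)
  also have "exp (1 / 2) \<le> (2 :: real)"
    using exp_bound[of "1 / 2"] by (simp add: power2_eq_square)
  finally have 2: "\<bar>(1 - real k / n) ^ j - (1 - real (Suc k) / n) ^ j\<bar> \<le> 2 * s * exp (- (s * k / 5))"
    using s by (simp add: mult_left_mono)
  have "\<bar>mult_diff n (Suc k) j - mult_diff n k j\<bar> \<le> 6 * s * exp (- (s * k / 5))"
    using 1 2 unfolding mult_diff_def by linarith
  then show ?thesis by (simp add: s_def)
qed

text \<open>Both multipliers are 1 at \<open>k = 0\<close>, so summing the increments gives 6 s k
  with s = j/n; separately each is at most exp (- s k / 5). The first bound serves for s k \<le> 1,
  where exp (- s k / 5) \<ge> 1/2 turns 6 into 12, the second for s k > 1.\<close>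

lemma mult_diff_bound:
  assumes "1 \<le> j" "2 * j \<le> n" "2 * k \<le> n"
  shows "\<bar>mult_diff n k j\<bar> \<le> 12 * (real j / n * k) * exp (- (real j / n * k / 5))"
proof -
  have n2: "n \<ge> 2" using assms by simp
  define s where "s = real j / n"
  have s: "s \<ge> 0" by (simp add: s_def)
  have lin: "\<bar>mult_diff n i j\<bar> \<le> 6 * s * i" if "i \<le> k" for i
    using that
  proof (induction i)
    case 0
    then show ?case by (simp add: mult_diff_def)
  next
    case (Suc i)
    have "\<bar>mult_diff n (Suc i) j - mult_diff n i j\<bar> \<le> 6 * s * exp (- (s * i / 5))"
      unfolding s_def using Suc.prems assms by (intro mult_diff_step) auto
    also have "\<dots> \<le> 6 * s * 1" using s by (intro mult_left_mono) auto
    finally show ?case using Suc by (simp add: algebra_simps)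
  qed
  have ex: "\<bar>mult_diff n k j\<bar> \<le> 2 * exp (- (s * k / 5))"
  proof -
    have "0 \<le> 1 - real k / n" using assms n2 by (simp add: field_simps)
    then have "(1 - real k / n) ^ j \<le> exp (- (real k / n)) ^ j"
      using exp_ge_add_one_self[of "- (real k / n)"] by (intro power_mono) auto
    also have "\<dots> = exp (- (s * k))"
      by (simp add: exp_of_nat_mult[symmetric] s_def)
    also have "\<dots> \<le> exp (- (s * k / 5))" using s by simp
    finally have "\<bar>(1 - real k / n) ^ j\<bar> \<le> exp (- (s * k / 5))"
      using \<open>0 \<le> 1 - real k / n\<close> by simp
    moreover have "\<bar>kraw n k j\<bar> \<le> exp (- (s * k / 5))"
      using kraw_exp_bound[OF assms(2,3)] by (simp add: s_def mult_ac)
    ultimately show ?thesis unfolding mult_diff_def by linarith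
  qed
  have "\<bar>mult_diff n k j\<bar> \<le> 12 * (s * k) * exp (- (s * k / 5))"
  proof (cases "s * k \<le> 1")
    case True
    have "1 / 2 \<le> exp (- (s * k / 5))"
      using exp_ge_add_one_self[of "- (s * k / 5)"] True by linarith
    then have "12 * (s * k) * (1 / 2) \<le> 12 * (s * k) * exp (- (s * k / 5))"
      using s by (intro mult_left_mono) auto
    then show ?thesis using lin[of k] by simp
  next
    case False
    then have "2 * exp (- (s * k / 5)) \<le> 12 * (s * k) * exp (- (s * k / 5))"
      by (intro mult_right_mono) auto
    then show ?thesis using ex by linarith
  qed
  then show ?thesis by (simp add: s_def)
qed

text \<open>For \<open>j > 0\<close> each summand is at most a multiple of s^2 (k + 1) q^k with s =
  j/n and q = exp (- 2 s / 5), and the series in k is at most 1/(1 - q)^2, of order 1/s^2: the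
  powers of s cancel. Here 180 = 12^2 + 6^2, and 1 - q \<ge> s/5 contributes the factor 25.\<close>

lemma mult_diff_square_sum:
  assumes "2 * j \<le> n" "2 * h \<le> n"
  shows "(\<Sum>k<h. (mult_diff n k j)\<^sup>2 / real (Suc k)
    + real (Suc k) * (mult_diff n (Suc k) j - mult_diff n k j)\<^sup>2) \<le> 4500"
proof (cases "j = 0")
  case True
  then show ?thesis using assms by (simp add: mult_diff_def)
next
  case False
  then have j: "1 \<le> j" by simp
  then have n2: "n \<ge> 2" using assms by simp
  define s where "s = real j / n"
  have s: "s > 0" "2 * s \<le> 1" using j assms n2 by (auto simp: s_def field_simps)
  define q where "q = exp (- (2 * s / 5))"
  have q: "0 \<le> q" "q < 1" using s by (auto simp: q_def)
  have e: "exp (- (s * k / 5)) ^ 2 = q ^ k" for k :: nat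
    by (simp add: q_def exp_of_nat_mult[symmetric] exp_double[symmetric])
  have "1 / (1 + 2 * s / 5) \<le> 1 - s / 5"
    using s mult_left_mono[of "2 * s" 1 s] by (simp add: field_simps power2_eq_square)
  moreover have "q \<le> 1 / (1 + 2 * s / 5)"
    using s exp_ge_add_one_self[of "2 * s / 5"] by (simp add: q_def exp_minus field_simps)
  ultimately have q': "s / 5 \<le> 1 - q" by simp
  have "(\<Sum>k<h. (mult_diff n k j)\<^sup>2 / real (Suc k)
    + real (Suc k) * (mult_diff n (Suc k) j - mult_diff n k j)\<^sup>2)
    \<le> (\<Sum>k<h. 180 * s\<^sup>2 * (real (Suc k) * q ^ k))"
  proof (rule sum_mono)
    fix k assume k: "k \<in> {..<h}"
    have "(mult_diff n k j)\<^sup>2 \<le> (12 * (s * k) * exp (- (s * k / 5)))\<^sup>2"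
      using mult_diff_bound[OF j assms(1), of k] k assms unfolding s_def
      by (intro power2_le_iff_abs_le[THEN iffD2]) auto
    also have "\<dots> = 144 * s\<^sup>2 * (real k)\<^sup>2 * q ^ k"
      by (simp add: power_mult_distrib e)
    finally have "(mult_diff n k j)\<^sup>2 / real (Suc k) \<le> 144 * s\<^sup>2 * (real k)\<^sup>2 * q ^ k / real (Suc k)"
      by (intro divide_right_mono) auto
    also have "\<dots> \<le> 144 * s\<^sup>2 * (real (Suc k) * q ^ k)"
    proof -
      have "(real k)\<^sup>2 / real (Suc k) \<le> real (Suc k)"
        by (simp add: field_simps power2_eq_square)
      then have "144 * s\<^sup>2 * q ^ k * ((real k)\<^sup>2 / real (Suc k)) \<le> 144 * s\<^sup>2 * q ^ k * real (Suc k)"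
        using q by (intro mult_left_mono) auto
      moreover have "144 * s\<^sup>2 * (real k)\<^sup>2 * q ^ k / real (Suc k)
          = 144 * s\<^sup>2 * q ^ k * ((real k)\<^sup>2 / real (Suc k))"
        by (simp add: divide_inverse mult_ac)
      ultimately show ?thesis by (simp only: mult_ac)
    qed
    finally have 1: "(mult_diff n k j)\<^sup>2 / real (Suc k) \<le> 144 * s\<^sup>2 * (real (Suc k) * q ^ k)" .
    have "(mult_diff n (Suc k) j - mult_diff n k j)\<^sup>2 \<le> (6 * s * exp (- (s * k / 5)))\<^sup>2"
      using mult_diff_step[OF j assms(1), of k] k assms s unfolding s_def
      by (intro power2_le_iff_abs_le[THEN iffD2]) auto
    also have "\<dots> = 36 * s\<^sup>2 * q ^ k" by (simp add: power_mult_distrib e)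
    finally have 2: "real (Suc k) * (mult_diff n (Suc k) j - mult_diff n k j)\<^sup>2
        \<le> real (Suc k) * (36 * s\<^sup>2 * q ^ k)" by (intro mult_left_mono) auto
    show "(mult_diff n k j)\<^sup>2 / real (Suc k)
      + real (Suc k) * (mult_diff n (Suc k) j - mult_diff n k j)\<^sup>2 \<le> 180 * s\<^sup>2 * (real (Suc k) * q ^ k)"
      using 1 2 by (simp add: algebra_simps)
  qed
  also have "\<dots> = 180 * s\<^sup>2 * (\<Sum>k<h. real (Suc k) * q ^ k)" by (simp add: sum_distrib_left)
  also have "\<dots> \<le> 180 * s\<^sup>2 * (1 / (1 - q)\<^sup>2)"
    using sum_Suc_mult_power_le[OF q] by (intro mult_left_mono) auto
  also have "\<dots> \<le> 180 * s\<^sup>2 * (1 / (s / 5)\<^sup>2)"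
    using q' s q by (intro mult_left_mono divide_left_mono power_mono) auto
  also have "\<dots> = 4500" using s by (simp add: power2_eq_square)
  finally show ?thesis .
qed

section \<open>Variation along monotone sequences\<close>

text \<open>The sampling sequence \<open>\<kappa>\<close> is only required to be nondecreasing where \<open>osc\<close> is estimated, so that
  it may be composed with truncations such as \<open>\<lambda>k. min k h\<close>.\<close>

definition osc :: "real \<Rightarrow> (nat \<Rightarrow> complex) \<Rightarrow> (nat \<Rightarrow> nat) \<Rightarrow> nat \<Rightarrow> real" where
  "osc r a \<kappa> J = (\<Sum>j<J. norm (a (\<kappa> (Suc j)) - a (\<kappa> j)) powr r) powr (1 / r)"

lemma osc_nonneg [simp]: "0 \<le> osc r a \<kappa> J"
  by (simp add: osc_def)

section \<open>Minkowski's inequality and the calculus of the r-variation\<close>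

lemma powr_convex_nonneg:
  fixes x y t r :: real
  assumes "1 \<le> r" "0 \<le> t" "t \<le> 1" "0 \<le> x" "0 \<le> y"
  shows "((1 - t) * x + t * y) powr r \<le> (1 - t) * x powr r + t * y powr r"
proof -
  have le: "s powr r \<le> s" if "0 \<le> s" "s \<le> 1" for s :: real
    using that assms(1) powr_mono'[of 1 r s] by simp
  consider "x = 0" | "y = 0" | "x > 0" "y > 0" using assms by fastforce
  then show ?thesis
  proof cases
    case 1
    then show ?thesis using assms le[of t] by (simp add: powr_mult mult_right_mono)
  next
    case 2
    then show ?thesis using assms le[of "1 - t"] by (simp add: powr_mult mult_right_mono)
  next
    case 3
    then show ?thesis using convex_onD[OF powr_convex[OF assms(1)], of t x y] assms by simp
  qed
qed

lemma Minkowski_powr: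
  fixes f g :: "'a \<Rightarrow> real" and r :: real
  assumes "1 \<le> r" "finite I" and f: "\<And>i. i \<in> I \<Longrightarrow> 0 \<le> f i" and g: "\<And>i. i \<in> I \<Longrightarrow> 0 \<le> g i"
  shows "(\<Sum>i\<in>I. (f i + g i) powr r) powr (1 / r)
    \<le> (\<Sum>i\<in>I. f i powr r) powr (1 / r) + (\<Sum>i\<in>I. g i powr r) powr (1 / r)"
proof -
  define A B where "A = (\<Sum>i\<in>I. f i powr r) powr (1 / r)" and "B = (\<Sum>i\<in>I. g i powr r) powr (1 / r)"
  have r: "r > 0" "r \<noteq> 0" using assms by auto
  have AB: "A \<ge> 0" "B \<ge> 0" by (auto simp: A_def B_def)
  have Ar: "A powr r = (\<Sum>i\<in>I. f i powr r)" and Br: "B powr r = (\<Sum>i\<in>I. g i powr r)"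
    using r by (simp_all add: A_def B_def powr_powr sum_nonneg)
  show ?thesis
  proof (cases "A = 0 \<or> B = 0")
    case True
    then show ?thesis
    proof
      assume "A = 0"
      then have "\<forall>i\<in>I. f i = 0" using Ar assms(2) by (simp add: sum_nonneg_eq_0_iff)
      then show ?thesis by (simp add: A_def[symmetric] AB)
    next
      assume "B = 0"
      then have "\<forall>i\<in>I. g i = 0" using Br assms(2) by (simp add: sum_nonneg_eq_0_iff)
      then show ?thesis by (simp add: B_def[symmetric] AB)
    qed
  next
    case False
    then have pos: "A > 0" "B > 0" using AB by auto
    \<comment> \<open>With this weight (f + g)/(A + B) is a convex combination of f/A and g/B, both
      of norm 1, so convexity of the r-th power suffices.\<close>
    define t where "t = B / (A + B)"
    have t: "0 \<le> t" "t \<le> 1" "1 - t = A / (A + B)" using pos by (auto simp: t_def field_simps)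
    have "(\<Sum>i\<in>I. (f i + g i) powr r) = (\<Sum>i\<in>I. (A + B) powr r * ((1 - t) * (f i / A) + t * (g i / B)) powr r)"
    proof (rule sum.cong)
      fix i assume i: "i \<in> I"
      have "f i + g i = (A + B) * ((1 - t) * (f i / A) + t * (g i / B))"
      proof -
        have "(1 - t) * (f i / A) = f i / (A + B)" "t * (g i / B) = g i / (A + B)"
          unfolding t(3) unfolding t_def using pos by auto
        then show ?thesis using pos by (simp add: add_divide_distrib[symmetric])
      qed
      then show "(f i + g i) powr r = (A + B) powr r * ((1 - t) * (f i / A) + t * (g i / B)) powr r"
        using pos t(1,2) f[OF i] g[OF i] by (metis powr_mult)
    qed simp
    also have "\<dots> \<le> (\<Sum>i\<in>I. (A + B) powr r * ((1 - t) * (f i / A) powr r + t * (g i / B) powr r))"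
      using f g pos t by (intro sum_mono mult_left_mono powr_convex_nonneg assms) auto
    also have "\<dots> = (\<Sum>i\<in>I. (A + B) powr r * ((1 - t) * (f i powr r / A powr r) + t * (g i powr r / B powr r)))"
      using f g pos by (intro sum.cong) (auto simp: powr_divide)
    also have "\<dots> = (A + B) powr r * ((1 - t) * ((\<Sum>i\<in>I. f i powr r) / A powr r)
        + t * ((\<Sum>i\<in>I. g i powr r) / B powr r))"
      by (simp only: sum_distrib_left[symmetric] sum.distrib sum_divide_distrib)
    also have "\<dots> = (A + B) powr r"
      unfolding Ar[symmetric] Br[symmetric] using pos by simp
    finally have "(\<Sum>i\<in>I. (f i + g i) powr r) powr (1 / r) \<le> ((A + B) powr r) powr (1 / r)"
      using r by (intro powr_mono2 sum_nonneg) auto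
    also have "\<dots> = A + B" using pos r by (simp add: powr_powr)
    finally show ?thesis by (simp add: A_def B_def)
  qed
qed

lemma sum_powr_le_powr_sum:
  fixes f :: "'a \<Rightarrow> real" and s :: real
  assumes "1 \<le> s" "finite I" and f: "\<And>i. i \<in> I \<Longrightarrow> 0 \<le> f i"
  shows "(\<Sum>i\<in>I. f i powr s) \<le> (\<Sum>i\<in>I. f i) powr s"
proof -
  define S where "S = (\<Sum>i\<in>I. f i)"
  have S: "0 \<le> S" unfolding S_def using f by (rule sum_nonneg)
  have split: "x powr s = x * x powr (s - 1)" if "0 \<le> x" for x :: real
    using that powr_add[of x 1 "s - 1"] by simp
  have "(\<Sum>i\<in>I. f i powr s) \<le> (\<Sum>i\<in>I. f i * S powr (s - 1))"
  proof (rule sum_mono)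
    fix i assume i: "i \<in> I"
    have "f i \<le> S" unfolding S_def using i f assms(2) by (intro member_le_sum) auto
    then show "f i powr s \<le> f i * S powr (s - 1)"
      using f[OF i] assms(1) unfolding split[OF f[OF i]] by (intro mult_left_mono powr_mono2) auto
  qed
  also have "\<dots> = S * S powr (s - 1)" by (simp add: S_def sum_distrib_right)
  finally show ?thesis using split[OF S] by (simp add: S_def)
qed

lemma osc_mono_norm:
  assumes "r > 0" "\<And>j. j < J \<Longrightarrow> norm (a (\<kappa> (Suc j)) - a (\<kappa> j)) \<le> c j"
  shows "osc r a \<kappa> J \<le> (\<Sum>j<J. c j powr r) powr (1 / r)"
  unfolding osc_def using assms by (intro powr_mono2 sum_mono sum_nonneg) auto

lemma osc_add:
  assumes "1 \<le> r"
  shows "osc r (\<lambda>k. a k + b k) \<kappa> J \<le> osc r a \<kappa> J + osc r b \<kappa> J"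
proof -
  have "osc r (\<lambda>k. a k + b k) \<kappa> J \<le>
     (\<Sum>j<J. (norm (a (\<kappa> (Suc j)) - a (\<kappa> j)) + norm (b (\<kappa> (Suc j)) - b (\<kappa> j))) powr r) powr (1 / r)"
    using assms by (intro osc_mono_norm) (auto simp: add_diff_add intro: norm_triangle_ineq)
  also have "\<dots> \<le> osc r a \<kappa> J + osc r b \<kappa> J"
    unfolding osc_def using assms by (intro Minkowski_powr) auto
  finally show ?thesis .
qed

lemma osc_const [simp]: "osc r (\<lambda>k. c) \<kappa> J = 0"
  by (simp add: osc_def)

lemma osc_sum:
  assumes "1 \<le> r" "finite I"
  shows "osc r (\<lambda>k. \<Sum>i\<in>I. a i k) \<kappa> J \<le> (\<Sum>i\<in>I. osc r (a i) \<kappa> J)"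
  using assms(2)
proof (induction I)
  case (insert i I)
  have "osc r (\<lambda>k. \<Sum>i\<in>insert i I. a i k) \<kappa> J = osc r (\<lambda>k. a i k + (\<Sum>i\<in>I. a i k)) \<kappa> J"
    using insert by simp
  also have "\<dots> \<le> osc r (a i) \<kappa> J + osc r (\<lambda>k. \<Sum>i\<in>I. a i k) \<kappa> J"
    by (rule osc_add[OF assms(1)])
  also have "\<dots> \<le> (\<Sum>i\<in>insert i I. osc r (a i) \<kappa> J)"
    using insert by simp
  finally show ?case .
qed simp

lemma osc_mult:
  assumes "r > 0"
  shows "osc r (\<lambda>k. c * a k) \<kappa> J = norm c * osc r a \<kappa> J"
proof -
  have "(\<Sum>j<J. norm (c * a (\<kappa> (Suc j)) - c * a (\<kappa> j)) powr r)
      = norm c powr r * (\<Sum>j<J. norm (a (\<kappa> (Suc j)) - a (\<kappa> j)) powr r)"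
    by (simp add: right_diff_distrib[symmetric] norm_mult powr_mult sum_distrib_left)
  then show ?thesis using assms
    by (simp add: osc_def powr_mult powr_powr sum_nonneg)
qed

lemma osc_le_sum_norm:
  assumes "1 \<le> r"
  shows "osc r a \<kappa> J \<le> (\<Sum>j<J. norm (a (\<kappa> (Suc j)) - a (\<kappa> j)))"
proof -
  have "osc r a \<kappa> J \<le> ((\<Sum>j<J. norm (a (\<kappa> (Suc j)) - a (\<kappa> j))) powr r) powr (1 / r)"
    unfolding osc_def using assms by (intro powr_mono2 sum_powr_le_powr_sum sum_nonneg) auto
  also have "\<dots> = (\<Sum>j<J. norm (a (\<kappa> (Suc j)) - a (\<kappa> j)))"
    using assms by (simp add: powr_powr sum_nonneg)
  finally show ?thesis .
qed

lemma osc_square_le: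
  assumes "2 \<le> r"
  shows "(osc r a \<kappa> J)\<^sup>2 \<le> (\<Sum>j<J. (norm (a (\<kappa> (Suc j)) - a (\<kappa> j)))\<^sup>2)"
proof -
  define S where "S = (\<Sum>j<J. (norm (a (\<kappa> (Suc j)) - a (\<kappa> j)))\<^sup>2)"
  have S: "0 \<le> S" by (auto simp: S_def sum_nonneg)
  have sq: "x powr r = (x\<^sup>2) powr (r / 2)" if "0 \<le> x" for x :: real
    using that powr_powr[of x 2 "r / 2"] by (simp add: powr_numeral)
  have "(\<Sum>j<J. norm (a (\<kappa> (Suc j)) - a (\<kappa> j)) powr r) =
     (\<Sum>j<J. ((norm (a (\<kappa> (Suc j)) - a (\<kappa> j)))\<^sup>2) powr (r / 2))"
    by (intro sum.cong sq) auto
  also have "\<dots> \<le> S powr (r / 2)"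
    unfolding S_def using assms by (intro sum_powr_le_powr_sum) auto
  finally have "osc r a \<kappa> J \<le> (S powr (r / 2)) powr (1 / r)"
    unfolding osc_def using assms by (intro powr_mono2 sum_nonneg) auto
  also have "\<dots> = sqrt S" using assms S by (simp add: powr_powr powr_half_sqrt)
  finally have "(osc r a \<kappa> J)\<^sup>2 \<le> (sqrt S)\<^sup>2" by (intro power_mono) auto
  then show ?thesis using S by (simp add: S_def)
qed

lemma osc_reverse: "osc r a \<kappa> J = osc r a (\<lambda>j. \<kappa> (J - j)) J"
proof -
  have "(\<Sum>j<J. norm (a (\<kappa> (J - Suc j)) - a (\<kappa> (J - j))) powr r)
      = (\<Sum>j<J. norm (a (\<kappa> (J - Suc j)) - a (\<kappa> (Suc (J - Suc j)))) powr r)"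
    by (intro sum.cong) (auto simp: Suc_diff_Suc)
  also have "\<dots> = (\<Sum>j<J. norm (a (\<kappa> j) - a (\<kappa> (Suc j))) powr r)"
    by (rule sum.nat_diff_reindex)
  finally show ?thesis by (simp add: osc_def norm_minus_commute)
qed

lemma osc_comp: "osc r (\<lambda>k. a (\<sigma> k)) \<kappa> J = osc r a (\<lambda>j. \<sigma> (\<kappa> j)) J"
  by (simp add: osc_def)

lemma osc_cong:
  assumes "\<And>j. j \<le> J \<Longrightarrow> a (\<kappa> j) = b (\<kappa> j)"
  shows "osc r a \<kappa> J = osc r b \<kappa> J"
  unfolding osc_def using assms by (intro arg_cong2[of _ _ _ _ "(powr)"] sum.cong refl) auto

section \<open>Bounding the 2-variation by a weighted square sum\<close>

lemma sum_consecutive_intervals_le: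
  fixes w :: "nat \<Rightarrow> real"
  assumes "mono \<kappa>" "\<kappa> J \<le> h" "\<And>i. 0 \<le> w i"
  shows "(\<Sum>j<J. \<Sum>i=\<kappa> j..<\<kappa> (Suc j). w i) \<le> (\<Sum>i<h. w i)"
proof -
  have m: "\<kappa> i \<le> \<kappa> j" if "i \<le> j" for i j using assms(1) that by (rule monoD)
  have "(\<Sum>j<J. \<Sum>i=\<kappa> j..<\<kappa> (Suc j). w i) = (\<Sum>i=\<kappa> 0..<\<kappa> J. w i)"
    by (induction J) (simp_all add: m sum.atLeastLessThan_concat)
  also have "\<dots> \<le> (\<Sum>i<h. w i)"
    using assms by (intro sum_mono2) auto
  finally show ?thesis .
qed

text \<open>A Sobolev-type estimate in the variable log k; let W be the sum over [k, l). On a short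
  interval, l - k \<le> k + 1, Cauchy-Schwarz applies because the 1/(i + 1) sum to at most 1. On a
  long one they sum to at least 1/2, so some u has |a_u|^2 \<le> 2 W; as |a_i|^2 varies by at most 2
  W on the interval, both ends have square at most 4 W, and 16 = 2 (4 + 4).\<close>

lemma norm_diff_square_le_weighted:
  fixes a :: "nat \<Rightarrow> complex"
  assumes "k < l"
  shows "(norm (a l - a k))\<^sup>2 \<le> 16 * (\<Sum>i=k..<l. (norm (a i))\<^sup>2 / real (Suc i)
     + real (Suc i) * (norm (a (Suc i) - a i))\<^sup>2)"
proof -
  define w where "w i = (norm (a i))\<^sup>2 / real (Suc i) + real (Suc i) * (norm (a (Suc i) - a i))\<^sup>2" for i
  define W where "W = (\<Sum>i=k..<l. w i)"
  have w0: "0 \<le> w i" for i by (simp add: w_def)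
  have W0: "0 \<le> W" by (simp add: W_def w0 sum_nonneg)
  have tel: "(\<Sum>i=k..<l. b (Suc i) - b i) = b l - b k" for b :: "nat \<Rightarrow> complex"
    using assms by (intro sum_Suc_diff') auto
  have step: "\<bar>(norm (a (Suc i)))\<^sup>2 - (norm (a i))\<^sup>2\<bar> \<le> 2 * w i" for i
  proof -
    define p q d c where "p = norm (a (Suc i))" and "q = norm (a i)" and "d = norm (a (Suc i) - a i)"
      and "c = real (Suc i)"
    have c: "c \<ge> 1" by (simp add: c_def)
    have pq: "\<bar>p - q\<bar> \<le> d" unfolding p_def q_def d_def by (rule norm_triangle_ineq3)
    have nn: "0 \<le> p" "0 \<le> q" "0 \<le> d" by (auto simp: p_def q_def d_def)
    have "\<bar>p\<^sup>2 - q\<^sup>2\<bar> = \<bar>p - q\<bar> * (p + q)"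
      using nn by (simp add: power2_eq_square square_diff_square_factored abs_mult)
    also have "\<dots> \<le> d * (2 * q + d)" using pq nn by (intro mult_mono) auto
    also have "\<dots> \<le> 2 * (q\<^sup>2 / c + c * d\<^sup>2)"
    proof -
      have "0 \<le> (q - c * d)\<^sup>2 / c" using c by simp
      also have "(q - c * d)\<^sup>2 / c = q\<^sup>2 / c + c * d\<^sup>2 - 2 * q * d"
        using c by (simp add: power2_eq_square field_simps)
      finally have 1: "2 * q * d \<le> q\<^sup>2 / c + c * d\<^sup>2" by simp
      have "d\<^sup>2 * 1 \<le> d\<^sup>2 * c" using c by (intro mult_left_mono) auto
      then have 2: "d\<^sup>2 \<le> c * d\<^sup>2" by (simp add: mult_ac)
      have 3: "0 \<le> q\<^sup>2 / c" using c by simp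
      have "d * (2 * q + d) = 2 * q * d + d\<^sup>2" by (simp add: algebra_simps power2_eq_square)
      also have "\<dots> \<le> (q\<^sup>2 / c + c * d\<^sup>2) + (q\<^sup>2 / c + c * d\<^sup>2)"
        using 1 2 3 by (intro add_mono) auto
      finally show ?thesis by simp
    qed
    finally show ?thesis by (simp add: p_def q_def d_def c_def w_def)
  qed
  have *: "\<bar>(norm (a u))\<^sup>2 - (norm (a v))\<^sup>2\<bar> \<le> 2 * W" if "k \<le> v" "v \<le> u" "u \<le> l" for u v
  proof -
    have "(norm (a u))\<^sup>2 - (norm (a v))\<^sup>2 = (\<Sum>i=v..<u. (norm (a (Suc i)))\<^sup>2 - (norm (a i))\<^sup>2)"
      using that by (intro sum_Suc_diff'[symmetric]) auto
    also have "\<bar>\<dots>\<bar> \<le> (\<Sum>i=v..<u. \<bar>(norm (a (Suc i)))\<^sup>2 - (norm (a i))\<^sup>2\<bar>)"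
      by (rule sum_abs)
    also have "\<dots> \<le> (\<Sum>i=v..<u. 2 * w i)" by (intro sum_mono step)
    also have "\<dots> \<le> (\<Sum>i=k..<l. 2 * w i)" using that w0 by (intro sum_mono2) auto
    finally show ?thesis by (simp add: W_def sum_distrib_left)
  qed
  have "(norm (a l - a k))\<^sup>2 \<le> 16 * W"
  proof (cases "l - k \<le> Suc k")
    case True
    have "norm (a l - a k) \<le> (\<Sum>i=k..<l. norm (a (Suc i) - a i))"
      unfolding tel[symmetric, of a] by (rule norm_sum)
    also have "\<dots> = (\<Sum>i=k..<l. sqrt (1 / real (Suc i)) * (sqrt (real (Suc i)) * norm (a (Suc i) - a i)))"
      by (intro sum.cong refl) (simp add: real_sqrt_mult[symmetric] mult.assoc[symmetric] del: of_nat_Suc)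
    finally have "(norm (a l - a k))\<^sup>2 \<le>
      (\<Sum>i=k..<l. sqrt (1 / real (Suc i)) * (sqrt (real (Suc i)) * norm (a (Suc i) - a i)))\<^sup>2"
      by (intro power_mono) auto
    also have "\<dots> \<le> (\<Sum>i=k..<l. (sqrt (1 / real (Suc i)))\<^sup>2) *
        (\<Sum>i=k..<l. (sqrt (real (Suc i)) * norm (a (Suc i) - a i))\<^sup>2)"
      by (rule Cauchy_Schwarz_ineq_sum)
    also have "\<dots> \<le> 1 * W"
    proof (rule mult_mono)
      have "(\<Sum>i=k..<l. (sqrt (1 / real (Suc i)))\<^sup>2) \<le> (\<Sum>i=k..<l. 1 / real (Suc k))"
        by (intro sum_mono) (auto simp: frac_le)
      also have "\<dots> = (real l - real k) / real (Suc k)" using assms by (simp add: of_nat_diff)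
      also have "\<dots> \<le> 1" using True assms by (simp add: field_simps)
      finally show "(\<Sum>i=k..<l. (sqrt (1 / real (Suc i)))\<^sup>2) \<le> 1" .
      show "(\<Sum>i=k..<l. (sqrt (real (Suc i)) * norm (a (Suc i) - a i))\<^sup>2) \<le> W"
        unfolding W_def by (intro sum_mono) (auto simp: w_def power_mult_distrib)
    qed (auto intro: sum_nonneg)
    finally show ?thesis using W0 by simp
  next
    case False
    have "\<exists>u\<in>{k..<l}. (norm (a u))\<^sup>2 \<le> 2 * W"
    proof (rule ccontr)
      assume "\<not> (\<exists>u\<in>{k..<l}. (norm (a u))\<^sup>2 \<le> 2 * W)"
      then have big: "2 * W < (norm (a u))\<^sup>2" if "u \<in> {k..<l}" for u
        using that by (meson not_le)
      have "W \<le> (real l - real k) * (2 * W / real l)"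
      proof -
        have "2 * k \<le> l" using False by simp
        then have "real l \<le> (real l - real k) * 2"
          using of_nat_mono[of "2 * k" l, where 'a = real] by simp
        then have "real l * W \<le> (real l - real k) * 2 * W" using W0 by (intro mult_right_mono) auto
        then show ?thesis using assms by (simp add: field_simps)
      qed
      also have "\<dots> = (\<Sum>i=k..<l. 2 * W / real l)" using assms by (simp add: of_nat_diff)
      also have "\<dots> < (\<Sum>i=k..<l. w i)"
      proof (rule sum_strict_mono)
        fix i assume i: "i \<in> {k..<l}"
        have "2 * W / real l \<le> 2 * W / real (Suc i)" using i W0 by (intro divide_left_mono) auto
        also have "\<dots> < (norm (a i))\<^sup>2 / real (Suc i)" using big[OF i] by (intro divide_strict_right_mono) auto
        also have "\<dots> \<le> w i" by (simp add: w_def)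
        finally show "2 * W / real l < w i" .
      qed (use assms in auto)
      finally show False by (simp add: W_def)
    qed
    then obtain u where u: "k \<le> u" "u < l" "(norm (a u))\<^sup>2 \<le> 2 * W" by auto
    have "(norm (a l))\<^sup>2 \<le> 4 * W" "(norm (a k))\<^sup>2 \<le> 4 * W"
      using *[of u l] *[of k u] u by auto
    moreover have "(norm (a l - a k))\<^sup>2 \<le> 2 * (norm (a l))\<^sup>2 + 2 * (norm (a k))\<^sup>2"
    proof -
      have "(norm (a l - a k))\<^sup>2 \<le> (norm (a l) + norm (a k))\<^sup>2"
        by (intro power_mono norm_triangle_ineq4) auto
      also have "\<dots> \<le> 2 * (norm (a l))\<^sup>2 + 2 * (norm (a k))\<^sup>2"
        using sum_squares_bound[of "norm (a l)" "norm (a k)"] by (simp add: power2_sum)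
      finally show ?thesis .
    qed
    ultimately show ?thesis by linarith
  qed
  then show ?thesis by (simp add: W_def w_def)
qed

lemma osc_square_le_weighted:
  assumes "2 \<le> r" "mono \<kappa>" "\<kappa> J \<le> h"
  shows "(osc r a \<kappa> J)\<^sup>2 \<le> 16 * (\<Sum>k<h. (norm (a k))\<^sup>2 / real (Suc k)
     + real (Suc k) * (norm (a (Suc k) - a k))\<^sup>2)"
proof -
  define w where "w i = 16 * ((norm (a i))\<^sup>2 / real (Suc i) + real (Suc i) * (norm (a (Suc i) - a i))\<^sup>2)" for i
  have "(osc r a \<kappa> J)\<^sup>2 \<le> (\<Sum>j<J. (norm (a (\<kappa> (Suc j)) - a (\<kappa> j)))\<^sup>2)"
    by (rule osc_square_le[OF assms(1)])
  also have "\<dots> \<le> (\<Sum>j<J. \<Sum>i=\<kappa> j..<\<kappa> (Suc j). w i)"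
  proof (rule sum_mono)
    fix j
    have "\<kappa> j \<le> \<kappa> (Suc j)" using assms(2) by (rule monoD) simp
    then consider "\<kappa> j = \<kappa> (Suc j)" | "\<kappa> j < \<kappa> (Suc j)" by linarith
    then show "(norm (a (\<kappa> (Suc j)) - a (\<kappa> j)))\<^sup>2 \<le> (\<Sum>i=\<kappa> j..<\<kappa> (Suc j). w i)"
    proof cases
      case 2
      then show ?thesis unfolding w_def sum_distrib_left[symmetric]
        by (rule norm_diff_square_le_weighted)
    qed simp
  qed
  also have "\<dots> \<le> (\<Sum>i<h. w i)"
    using assms by (intro sum_consecutive_intervals_le) (auto simp: w_def)
  finally show ?thesis by (simp add: w_def sum_distrib_left)
qed

section \<open>Lepingle's inequality\<close>

fun runmax :: "(nat \<Rightarrow> complex) \<Rightarrow> nat \<Rightarrow> real" where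
  "runmax f 0 = norm (f 0)"
| "runmax f (Suc t) = max (runmax f t) (norm (f (Suc t)))"

text \<open>\<open>jump_track\<close> is \<open>f\<close> sampled at the successive times at which it has moved by at least \<open>\<epsilon>\<close> times
  the running maximum; the recursive form replaces stopping times.\<close>

fun jump_track :: "real \<Rightarrow> (nat \<Rightarrow> complex) \<Rightarrow> nat \<Rightarrow> complex" where
  "jump_track \<epsilon> f 0 = f 0"
| "jump_track \<epsilon> f (Suc t) =
    (if \<epsilon> * runmax f (Suc t) \<le> norm (f (Suc t) - jump_track \<epsilon> f t)
     then f (Suc t) else jump_track \<epsilon> f t)"

lemma runmax_nonneg: "0 \<le> runmax f t"
  by (induction t) (auto simp: le_max_iff_disj)

lemma norm_le_runmax: "s \<le> t \<Longrightarrow> norm (f s) \<le> runmax f t"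
  by (induction t) (auto simp: le_Suc_eq)

lemma runmax_mono: "s \<le> t \<Longrightarrow> runmax f s \<le> runmax f t"
  by (induction t) (auto simp: le_Suc_eq)

lemma runmax_attained: "\<exists>s\<le>t. runmax f t = norm (f s)"
proof (induction t)
  case (Suc t)
  then show ?case by (metis le_Suc_eq max_def order_refl runmax.simps(2))
qed simp

lemma jump_track_close: "0 \<le> \<epsilon> \<Longrightarrow> norm (f t - jump_track \<epsilon> f t) \<le> \<epsilon> * runmax f t"
  by (cases t) (auto simp: runmax_nonneg le_max_iff_disj)

text \<open>For a frozen value g, |f_(t+1) - g|^2 - |f_t - g|^2 is the increment of |f|^2 minus
  twice Re (cnj g (f_(t+1) - f_t)). At a jump the distance to the track is converted into the square
  of the jump, otherwise it is kept. The last sum is a martingale transform and disappears on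
  summation over the space.\<close>

lemma jump_track_sum_squares:
  "(norm (f N - jump_track \<epsilon> f N))\<^sup>2 + (\<Sum>t<N. (norm (jump_track \<epsilon> f (Suc t) - jump_track \<epsilon> f t))\<^sup>2)
   = (norm (f N))\<^sup>2 - (norm (f 0))\<^sup>2 - 2 * Re (\<Sum>t<N. cnj (jump_track \<epsilon> f t) * (f (Suc t) - f t))"
proof (induction N)
  case (Suc N)
  have "(norm (f (Suc N) - jump_track \<epsilon> f (Suc N)))\<^sup>2
      + (norm (jump_track \<epsilon> f (Suc N) - jump_track \<epsilon> f N))\<^sup>2 = (norm (f (Suc N) - jump_track \<epsilon> f N))\<^sup>2"
    by auto
  moreover have "(norm (f (Suc N) - g))\<^sup>2 - (norm (f N - g))\<^sup>2
     = (norm (f (Suc N)))\<^sup>2 - (norm (f N))\<^sup>2 - 2 * Re (cnj g * (f (Suc N) - f N))" for g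
    by (simp add: cmod_power2) (simp add: power2_eq_square algebra_simps)
  note this[of "jump_track \<epsilon> f N"]
  ultimately show ?case using Suc.IH by simp
qed simp

lemma jump_track_constant:
  assumes "k \<le> l"
    and "\<And>i. k \<le> i \<Longrightarrow> i < l \<Longrightarrow> norm (f (Suc i) - jump_track \<epsilon> f i) < \<epsilon> * runmax f (Suc i)"
  shows "jump_track \<epsilon> f l = jump_track \<epsilon> f k"
  using assms
proof (induction l)
  case (Suc l)
  show ?case
  proof (cases "k = Suc l")
    case False
    then have "jump_track \<epsilon> f l = jump_track \<epsilon> f k" using Suc by auto
    then show ?thesis using Suc.prems(2)[of l] Suc.prems(1) False by simp
  qed simp
qed simp

text \<open>The last jump before \<open>l\<close> happens at a time when the running maximum is already comparable
  to \<open>runmax f l\<close>: otherwise the growth of the maximum would have forced a further jump.\<close>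

lemma exists_comparable_jump:
  assumes \<epsilon>: "0 < \<epsilon>" "\<epsilon> \<le> 1 / 2" and kl: "k < l"
    and big: "2 * \<epsilon> * runmax f l < norm (f l - f k)"
  shows "\<exists>i\<in>{k..<l}. \<epsilon> * runmax f l / 2 \<le> norm (jump_track \<epsilon> f (Suc i) - jump_track \<epsilon> f i)"
proof -
  let ?g = "jump_track \<epsilon> f"
  define I where "I = {i\<in>{k..<l}. \<epsilon> * runmax f (Suc i) \<le> norm (f (Suc i) - ?g i)}"
  have "I \<noteq> {}"
  proof
    assume "I = {}"
    \<comment> \<open>Without a jump in [k, l), \<open>f k\<close> and \<open>f l\<close> stay
      within \<epsilon> times the maximum of one value of the track, against
      \<open>big\<close>.\<close>
    then have "?g l = ?g k"
      using kl by (intro jump_track_constant) (auto simp: I_def not_le)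
    then have "f l - f k = (f l - ?g l) - (f k - ?g k)" by simp
    then have "norm (f l - f k) \<le> norm (f l - ?g l) + norm (f k - ?g k)"
      by (metis norm_triangle_ineq4)
    also have "\<dots> \<le> \<epsilon> * runmax f l + \<epsilon> * runmax f k"
      using \<epsilon> by (intro add_mono jump_track_close) auto
    also have "\<epsilon> * runmax f k \<le> \<epsilon> * runmax f l"
      using \<epsilon> kl by (intro mult_left_mono runmax_mono) auto
    finally show False using big by simp
  qed
  moreover have fin: "finite I" by (simp add: I_def)
  ultimately have "Max I \<in> I" by (rule Max_in[rotated])
  define i where "i = Max I"
  have i: "k \<le> i" "i < l" "\<epsilon> * runmax f (Suc i) \<le> norm (f (Suc i) - ?g i)"
    using \<open>Max I \<in> I\<close> by (auto simp: I_def i_def)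
  have gi: "?g (Suc i) = f (Suc i)" using i(3) by simp
  have const: "?g s = f (Suc i)" if s: "Suc i \<le> s" "s \<le> l" for s
  proof -
    have "?g s = ?g (Suc i)"
    proof (rule jump_track_constant[OF s(1)])
      fix u assume u: "Suc i \<le> u" "u < s"
      then have "u \<notin> I" using Max_ge[OF fin, of u] by (auto simp: i_def)
      then show "norm (f (Suc u) - ?g u) < \<epsilon> * runmax f (Suc u)"
        using u s i by (auto simp: I_def)
    qed
    then show ?thesis by (simp only: gi)
  qed
  have half: "runmax f l / 2 \<le> runmax f (Suc i)"
  proof -
    obtain s where s: "s \<le> l" "runmax f l = norm (f s)" using runmax_attained by blast
    show ?thesis
    proof (cases "s \<le> Suc i")
      case True
      then show ?thesis using norm_le_runmax[OF True, of f] s runmax_nonneg[of f l] by linarith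
    next
      case False
      \<comment> \<open>Past the last jump the track stays at \<open>f (Suc i)\<close>, so a maximum
        attained at s differs from it by at most \<epsilon> times, hence at most half, the
        maximum.\<close>
      have "norm (f s) - norm (f (Suc i)) \<le> norm (f s - f (Suc i))" by (rule norm_triangle_ineq2)
      also have "\<dots> = norm (f s - ?g s)" using const[of s] False s by simp
      also have "\<dots> \<le> \<epsilon> * runmax f s" using \<epsilon> by (intro jump_track_close) simp
      also have "\<dots> \<le> 1 / 2 * runmax f l"
        using \<epsilon> s by (intro mult_mono runmax_mono runmax_nonneg) auto
      finally have "runmax f l / 2 \<le> norm (f (Suc i))" using s by simp
      also have "\<dots> \<le> runmax f (Suc i)" by (rule norm_le_runmax) simp
      finally show ?thesis .
    qed
  qed
  have "\<epsilon> * runmax f l / 2 \<le> \<epsilon> * runmax f (Suc i)"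
    using mult_left_mono[OF half, of \<epsilon>] \<epsilon> by simp
  also have "\<dots> \<le> norm (?g (Suc i) - ?g i)" using i(3) unfolding gi .
  finally show ?thesis using i by auto
qed

section \<open>Pathwise bound of the r-variation by jumps at dyadic scales\<close>

lemma exists_dyadic_scale:
  fixes d M :: real
  assumes "0 < d" "d \<le> 2 * M"
  shows "\<exists>m. 2 * (1 / 2) ^ Suc m * M < d \<and> d \<le> 4 * (1 / 2) ^ Suc m * M"
proof -
  have M: "M > 0" using assms by simp
  let ?P = "\<lambda>m. 2 * (1 / 2) ^ m * M < d"
  have "\<exists>m. (1 / 2 :: real) ^ m < d / (2 * M)"
    using M assms by (intro real_arch_pow_inv) auto
  then obtain m0 where "?P m0" using M by (auto simp: field_simps)
  then have P: "?P (LEAST m. ?P m)" by (rule LeastI)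
  \<comment> \<open>Scale 0 fails by \<open>d \<le> 2 * M\<close>, so the least scale is a
    successor. Failure at its predecessor is the upper bound sought, and (1/2)^(m+1) is at most 1/2,
    as \<open>exists_comparable_jump\<close> demands.\<close>
  then have "(LEAST m. ?P m) \<noteq> 0" using assms by (metis mult.right_neutral not_le power_0)
  then obtain m where m: "(LEAST m. ?P m) = Suc m" using not0_implies_Suc by blast
  then have "\<not> ?P m" by (metis lessI not_less_Least)
  then show ?thesis using P m by (intro exI[of _ m]) auto
qed

text \<open>A square function of the jumps at the scales \<epsilon> = 1/2, ..., (1/2)^L. The weight
  \<epsilon>^(r - 2) is what remains when the r-th power of an increment of size about \<epsilon>
  times the maximum is split into a power r - 2 and a square. The cut-off L keeps all sums
  finite.\<close>

definition jump_energy :: "real \<Rightarrow> nat \<Rightarrow> (nat \<Rightarrow> complex) \<Rightarrow> nat \<Rightarrow> real" where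
  "jump_energy r L f i = (\<Sum>m<L. ((1 / 2) ^ Suc m) powr (r - 2) *
     (norm (jump_track ((1 / 2) ^ Suc m) f (Suc i) - jump_track ((1 / 2) ^ Suc m) f i))\<^sup>2)"

lemma jump_energy_nonneg: "0 \<le> jump_energy r L f i"
  unfolding jump_energy_def by (intro sum_nonneg) auto

text \<open>Take the dyadic \<epsilon> with 2 \<epsilon> M < d \<le> 4 \<epsilon> M for d = |f l - f
  k| > 0 and M = \<open>runmax f l\<close>. Some jump in [k, l) has size at least \<epsilon> M / 2
  \<ge> d/8. In d^r = d^(r-2) d^2 the first factor is estimated by 4 \<epsilon> times the maximum,
  the second by 8 times the jump. Allowing all large \<open>L\<close> lets finitely many increments
  share one cut-off.\<close>

lemma increment_le_jump_energy:
  assumes r: "2 < r" and kl: "k < l" "l \<le> N"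
  shows "\<exists>L0. \<forall>L\<ge>L0. norm (f l - f k) powr r \<le>
    64 * (4 * runmax f N) powr (r - 2) * (\<Sum>i=k..<l. jump_energy r L f i)"
proof (cases "f l = f k")
  case True
  then show ?thesis by (auto simp: sum_nonneg jump_energy_nonneg)
next
  case False
  define d where "d = norm (f l - f k)"
  have d: "0 < d" using False by (simp add: d_def)
  have "d \<le> norm (f l) + norm (f k)" unfolding d_def by (rule norm_triangle_ineq4)
  also have "\<dots> \<le> runmax f l + runmax f l" using kl by (intro add_mono norm_le_runmax) auto
  finally have "d \<le> 2 * runmax f l" by simp
  from exists_dyadic_scale[OF d this] obtain m
    where m: "2 * (1 / 2) ^ Suc m * runmax f l < d" "d \<le> 4 * (1 / 2) ^ Suc m * runmax f l" by blast
  define \<epsilon> where "\<epsilon> = (1 / 2 :: real) ^ Suc m"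
  have \<epsilon>: "0 < \<epsilon>" "\<epsilon> \<le> 1 / 2" by (auto simp: \<epsilon>_def power_le_one)
  let ?g = "jump_track \<epsilon> f"
  obtain i where i: "i \<in> {k..<l}" "\<epsilon> * runmax f l / 2 \<le> norm (?g (Suc i) - ?g i)"
    using exists_comparable_jump[OF \<epsilon> kl(1), of f] m(1) by (auto simp: d_def \<epsilon>_def)
  have d1: "d \<le> 4 * \<epsilon> * runmax f N"
  proof -
    have "d \<le> 4 * \<epsilon> * runmax f l" using m(2) by (simp add: \<epsilon>_def)
    also have "\<dots> \<le> 4 * \<epsilon> * runmax f N" using \<epsilon> kl by (intro mult_left_mono runmax_mono) auto
    finally show ?thesis .
  qed
  have d2: "d \<le> 8 * norm (?g (Suc i) - ?g i)" using m(2) i(2) by (simp add: \<epsilon>_def)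
  have "d powr r \<le> 64 * (4 * runmax f N) powr (r - 2) * (\<Sum>i=k..<l. jump_energy r L f i)"
    if L: "Suc m \<le> L" for L
  proof -
    have "d powr r = d powr (r - 2) * d\<^sup>2"
      using d powr_add[of d "r - 2" 2] by (simp add: powr_numeral)
    also have "\<dots> \<le> (4 * \<epsilon> * runmax f N) powr (r - 2) * (8 * norm (?g (Suc i) - ?g i))\<^sup>2"
      using d d1 d2 r by (intro mult_mono powr_mono2 power_mono) auto
    also have "\<dots> = 64 * (4 * runmax f N) powr (r - 2) *
        (\<epsilon> powr (r - 2) * (norm (?g (Suc i) - ?g i))\<^sup>2)"
    proof -
      have "(4 * \<epsilon> * runmax f N) powr (r - 2) = (4 * runmax f N) powr (r - 2) * \<epsilon> powr (r - 2)"
        using \<epsilon> runmax_nonneg[of f N] powr_mult[of "4 * runmax f N" \<epsilon> "r - 2"] by (simp add: mult_ac)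
      then show ?thesis by (simp add: power_mult_distrib)
    qed
    also have "\<epsilon> powr (r - 2) * (norm (?g (Suc i) - ?g i))\<^sup>2 \<le> jump_energy r L f i"
      unfolding jump_energy_def \<epsilon>_def
      using L by (intro member_le_sum[where f = "\<lambda>m. ((1 / 2) ^ Suc m) powr (r - 2) *
        (norm (jump_track ((1 / 2) ^ Suc m) f (Suc i) - jump_track ((1 / 2) ^ Suc m) f i))\<^sup>2"]) auto
    also have "jump_energy r L f i \<le> (\<Sum>i=k..<l. jump_energy r L f i)"
      using i(1) by (intro member_le_sum jump_energy_nonneg) auto
    finally show ?thesis using runmax_nonneg[of f N] by (simp add: mult_left_mono)
  qed
  then show ?thesis unfolding d_def by blast
qed

lemma osc_le_jump_energy:
  assumes r: "2 < r" and "mono \<kappa>" "\<kappa> J \<le> N"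
  shows "\<exists>L0. \<forall>L\<ge>L0. (\<Sum>j<J. norm (f (\<kappa> (Suc j)) - f (\<kappa> j)) powr r) \<le>
    64 * (4 * runmax f N) powr (r - 2) * (\<Sum>i<N. jump_energy r L f i)"
proof -
  have m: "\<kappa> i \<le> \<kappa> j" if "i \<le> j" for i j using assms(2) that by (rule monoD)
  have "\<exists>L0. \<forall>L\<ge>L0. norm (f (\<kappa> (Suc j)) - f (\<kappa> j)) powr r \<le>
    64 * (4 * runmax f N) powr (r - 2) * (\<Sum>i=\<kappa> j..<\<kappa> (Suc j). jump_energy r L f i)" if "j < J" for j
  proof (cases "\<kappa> j = \<kappa> (Suc j)")
    case False
    then have "\<kappa> j < \<kappa> (Suc j)" using m[of j "Suc j"] by simp
    moreover have "\<kappa> (Suc j) \<le> N" using m[of "Suc j" J] that assms(3) by simp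
    ultimately show ?thesis by (intro increment_le_jump_energy r)
  qed simp
  then have "\<forall>\<^sub>F L in sequentially. \<forall>j\<in>{..<J}. norm (f (\<kappa> (Suc j)) - f (\<kappa> j)) powr r \<le>
    64 * (4 * runmax f N) powr (r - 2) * (\<Sum>i=\<kappa> j..<\<kappa> (Suc j). jump_energy r L f i)"
    unfolding eventually_ball_finite_distrib[OF finite_lessThan] by (simp add: eventually_sequentially)
  then obtain L0 where L0: "\<And>L j. L0 \<le> L \<Longrightarrow> j < J \<Longrightarrow> norm (f (\<kappa> (Suc j)) - f (\<kappa> j)) powr r \<le>
    64 * (4 * runmax f N) powr (r - 2) * (\<Sum>i=\<kappa> j..<\<kappa> (Suc j). jump_energy r L f i)"
    by (auto simp: eventually_sequentially)
  show ?thesis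
  proof (intro exI[of _ L0] allI impI)
    fix L assume L: "L0 \<le> L"
    have "(\<Sum>j<J. norm (f (\<kappa> (Suc j)) - f (\<kappa> j)) powr r) \<le>
      (\<Sum>j<J. 64 * (4 * runmax f N) powr (r - 2) * (\<Sum>i=\<kappa> j..<\<kappa> (Suc j). jump_energy r L f i))"
      by (intro sum_mono L0[OF L]) auto
    also have "\<dots> = 64 * (4 * runmax f N) powr (r - 2) *
        (\<Sum>j<J. \<Sum>i=\<kappa> j..<\<kappa> (Suc j). jump_energy r L f i)"
      by (simp add: sum_distrib_left)
    also have "\<dots> \<le> 64 * (4 * runmax f N) powr (r - 2) * (\<Sum>i<N. jump_energy r L f i)"
      using runmax_nonneg[of f N] assms
      by (intro mult_left_mono sum_consecutive_intervals_le jump_energy_nonneg) auto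
    finally show "(\<Sum>j<J. norm (f (\<kappa> (Suc j)) - f (\<kappa> j)) powr r) \<le>
      64 * (4 * runmax f N) powr (r - 2) * (\<Sum>i<N. jump_energy r L f i)" .
  qed
qed

text \<open>With M the maximum and T the energy, M^(r-2) T \<le> B^(r/2) for B = M^2 + T; the power
  2/r then makes the bound linear in M^2 and T, so that it can be summed over the points of the
  space.\<close>

lemma osc_square_le_jump_energy:
  assumes r: "2 < r" and "mono \<kappa>" "\<kappa> J \<le> N"
  shows "\<exists>L0. \<forall>L\<ge>L0. (osc r f \<kappa> J)\<^sup>2 \<le>
    (64 * 4 powr (r - 2)) powr (2 / r) * ((runmax f N)\<^sup>2 + (\<Sum>i<N. jump_energy r L f i))"
proof -
  obtain L0 where L0: "\<And>L. L0 \<le> L \<Longrightarrow> (\<Sum>j<J. norm (f (\<kappa> (Suc j)) - f (\<kappa> j)) powr r) \<le>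
    64 * (4 * runmax f N) powr (r - 2) * (\<Sum>i<N. jump_energy r L f i)"
    using osc_le_jump_energy[OF assms] by blast
  show ?thesis
  proof (intro exI[of _ L0] allI impI)
    fix L assume L: "L0 \<le> L"
    define M T where "M = runmax f N" and "T = (\<Sum>i<N. jump_energy r L f i)"
    define B where "B = M\<^sup>2 + T"
    have M: "0 \<le> M" by (simp add: M_def runmax_nonneg)
    have T: "0 \<le> T" by (auto simp: T_def intro: sum_nonneg jump_energy_nonneg)
    have B: "0 \<le> B" "M\<^sup>2 \<le> B" "T \<le> B" using T by (auto simp: B_def)
    define S where "S = (\<Sum>j<J. norm (f (\<kappa> (Suc j)) - f (\<kappa> j)) powr r)"
    have S0: "0 \<le> S" by (auto simp: S_def intro: sum_nonneg)
    have MT: "M powr (r - 2) * T \<le> B powr (r / 2)"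
    proof (cases "B = 0")
      case True
      then show ?thesis using T B by simp
    next
      case False
      have "M powr (r - 2) = (M\<^sup>2) powr ((r - 2) / 2)"
      proof -
        have "M\<^sup>2 = M powr 2" using M by (simp add: powr_numeral)
        moreover have "2 * ((r - 2) / 2) = r - 2" by simp
        ultimately show ?thesis by (simp only: powr_powr)
      qed
      also have "\<dots> \<le> B powr ((r - 2) / 2)" using B r by (intro powr_mono2) auto
      finally have "M powr (r - 2) * T \<le> B powr ((r - 2) / 2) * B"
        using B T by (intro mult_mono) auto
      also have "\<dots> = B powr ((r - 2) / 2 + 1)" using B False by (simp add: powr_add)
      also have "(r - 2) / 2 + 1 = r / 2" by (simp add: field_simps)
      finally show ?thesis .
    qed
    have "S \<le> 64 * (4 * M) powr (r - 2) * T"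
      using L0[OF L] by (simp add: S_def M_def T_def)
    also have "\<dots> = 64 * 4 powr (r - 2) * (M powr (r - 2) * T)"
      using M by (simp add: powr_mult)
    also have "\<dots> \<le> 64 * 4 powr (r - 2) * B powr (r / 2)"
      using MT by (intro mult_left_mono) auto
    finally have "S powr (2 / r) \<le> (64 * 4 powr (r - 2) * B powr (r / 2)) powr (2 / r)"
      using S0 r by (intro powr_mono2) auto
    also have "\<dots> = (64 * 4 powr (r - 2)) powr (2 / r) * B"
      using r B by (simp add: powr_mult powr_powr)
    finally have "S powr (2 / r) \<le> (64 * 4 powr (r - 2)) powr (2 / r) * B" .
    moreover have "(osc r f \<kappa> J)\<^sup>2 = S powr (2 / r)"
    proof (cases "S = 0")
      case False
      then show ?thesis using S0
        by (simp add: osc_def S_def[symmetric] power2_eq_square powr_add[symmetric] add_divide_distrib[symmetric])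
    qed (simp add: osc_def S_def[symmetric])
    ultimately show "(osc r f \<kappa> J)\<^sup>2 \<le> (64 * 4 powr (r - 2)) powr (2 / r) *
      ((runmax f N)\<^sup>2 + (\<Sum>i<N. jump_energy r L f i))"
      by (simp add: B_def M_def T_def)
  qed
qed

section \<open>Maximal and energy estimates for finite martingales\<close>

lemma runmax_pathwise:
  "(\<Sum>t<N. runmax f t * (norm (f (Suc t)) - norm (f t))) \<le> runmax f N * norm (f N) - (runmax f N)\<^sup>2 / 2"
proof (induction N)
  case (Suc N)
  let ?m = "runmax f N" and ?s = "norm (f (Suc N))"
  have "(\<Sum>t<Suc N. runmax f t * (norm (f (Suc t)) - norm (f t))) \<le> ?m * ?s - ?m\<^sup>2 / 2"
    using Suc by (simp add: algebra_simps)
  \<comment> \<open>As a function of u, u s - u^2/2 is largest at u = s, and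
    \<open>max ?m ?s\<close> is either \<open>?m\<close> or \<open>?s\<close>.\<close>
  also have "\<dots> \<le> max ?m ?s * ?s - (max ?m ?s)\<^sup>2 / 2"
    using sum_squares_bound[of ?m ?s] by (simp add: max_def power2_eq_square)
  finally show ?case by simp
qed (simp add: power2_eq_square)

text \<open>\<open>R t\<close> plays the role of the \<open>\<sigma>\<close>-algebra at time \<open>t\<close>: a function is measurable when it is
  constant on \<open>R t\<close>-related points.\<close>

locale finite_martingale =
  fixes X :: "'a set" and R :: "nat \<Rightarrow> 'a \<Rightarrow> 'a \<Rightarrow> bool" and F :: "nat \<Rightarrow> 'a \<Rightarrow> complex" and N :: nat
  assumes finite_X: "finite X"
    and refining: "\<And>t x y. R (Suc t) x y \<Longrightarrow> R t x y"
    and adapted: "\<And>t x y. t \<le> N \<Longrightarrow> x \<in> X \<Longrightarrow> y \<in> X \<Longrightarrow> R t x y \<Longrightarrow> F t x = F t y"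
    and martingale: "\<And>t G. t < N \<Longrightarrow> (\<And>x y. x \<in> X \<Longrightarrow> y \<in> X \<Longrightarrow> R t x y \<Longrightarrow> G x = G y) \<Longrightarrow>
      (\<Sum>x\<in>X. G x * (F (Suc t) x - F t x)) = 0"
begin

lemma adapted_runmax:
  assumes "x \<in> X" "y \<in> X"
  shows "t \<le> N \<Longrightarrow> R t x y \<Longrightarrow> runmax (\<lambda>t. F t x) t = runmax (\<lambda>t. F t y) t"
proof (induction t)
  case (Suc t)
  then show ?case using adapted[OF _ assms, of "Suc t"] refining by simp
qed (use assms adapted[of 0] in simp)

lemma adapted_jump_track:
  assumes "x \<in> X" "y \<in> X"
  shows "t \<le> N \<Longrightarrow> R t x y \<Longrightarrow> jump_track \<epsilon> (\<lambda>t. F t x) t = jump_track \<epsilon> (\<lambda>t. F t y) t"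
proof (induction t)
  case (Suc t)
  have "jump_track \<epsilon> (\<lambda>t. F t x) t = jump_track \<epsilon> (\<lambda>t. F t y) t"
    using Suc refining by auto
  moreover have "runmax (\<lambda>t. F t x) (Suc t) = runmax (\<lambda>t. F t y) (Suc t)"
    using assms Suc.prems by (rule adapted_runmax)
  moreover have "F (Suc t) x = F (Suc t) y" using Suc.prems assms by (intro adapted)
  ultimately show ?case by (simp only: jump_track.simps)
qed (use assms adapted[of 0] in simp)

text \<open>\<open>runmax_pathwise\<close> is summed over X. Its left side has nonnegative sum
  because |F| is a submartingale, tested here against the adapted weight \<open>m t\<close>;
  completing the square, m |F| - m^2/2 \<le> |F|^2 - m^2/4, then gives the constant 4.\<close>

lemma Doob_maximal:
  "(\<Sum>x\<in>X. (runmax (\<lambda>t. F t x) N)\<^sup>2) \<le> 4 * (\<Sum>x\<in>X. (norm (F N x))\<^sup>2)"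
proof -
  define m where "m t x = runmax (\<lambda>t. F t x) t" for t x
  have nonneg: "0 \<le> (\<Sum>x\<in>X. m t x * (norm (F (Suc t) x) - norm (F t x)))" if t: "t < N" for t
  proof -
    \<comment> \<open>The conjugate phase of \<open>F t x\<close> makes this adapted test function
      reproduce m |F_t| exactly and send F_(t+1) to at most m |F_(t+1)| in real part.\<close>
    define G where "G x = complex_of_real (m t x) * cnj (sgn (F t x))" for x
    have "(\<Sum>x\<in>X. G x * (F (Suc t) x - F t x)) = 0"
    proof (rule martingale[OF t])
      fix x y assume xy: "x \<in> X" "y \<in> X" "R t x y"
      then show "G x = G y" using adapted_runmax[of x y t] adapted[of t x y] t
        by (simp add: G_def m_def)
    qed
    then have "0 = (\<Sum>x\<in>X. Re (G x * (F (Suc t) x - F t x)))" by (metis Re_sum zero_complex.simps(1))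
    also have "\<dots> \<le> (\<Sum>x\<in>X. m t x * (norm (F (Suc t) x) - norm (F t x)))"
    proof (rule sum_mono)
      fix x assume "x \<in> X"
      define u where "u = cnj (sgn (F t x))"
      have u: "norm u \<le> 1" by (simp add: u_def norm_sgn)
      have "u * F t x = complex_of_real (norm (F t x))"
      proof (cases "F t x = 0")
        case False
        have "u * F t x = cnj (F t x) * F t x / complex_of_real (norm (F t x))"
          by (simp add: u_def sgn_eq)
        also have "cnj (F t x) * F t x = complex_of_real (norm (F t x)) * complex_of_real (norm (F t x))"
          using complex_norm_square[of "F t x"] by (simp add: power2_eq_square mult.commute)
        finally show ?thesis using False by simp
      qed (simp add: u_def)
      then have 1: "Re (u * F t x) = norm (F t x)" by simp
      have "Re (u * F (Suc t) x) \<le> norm (u * F (Suc t) x)" by (rule complex_Re_le_cmod)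
      also have "\<dots> \<le> 1 * norm (F (Suc t) x)"
        unfolding norm_mult using u by (intro mult_right_mono) auto
      finally have 2: "Re (u * (F (Suc t) x - F t x)) \<le> norm (F (Suc t) x) - norm (F t x)"
        using 1 by (simp add: right_diff_distrib)
      have "Re (G x * (F (Suc t) x - F t x)) = m t x * Re (u * (F (Suc t) x - F t x))"
        by (simp add: G_def u_def mult.assoc)
      also have "\<dots> \<le> m t x * (norm (F (Suc t) x) - norm (F t x))"
        using 2 by (intro mult_left_mono) (auto simp: m_def runmax_nonneg)
      finally show "Re (G x * (F (Suc t) x - F t x)) \<le> m t x * (norm (F (Suc t) x) - norm (F t x))" .
    qed
    finally show ?thesis .
  qed
  have "0 \<le> (\<Sum>t<N. \<Sum>x\<in>X. m t x * (norm (F (Suc t) x) - norm (F t x)))"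
    by (intro sum_nonneg nonneg) auto
  also have "\<dots> = (\<Sum>x\<in>X. \<Sum>t<N. m t x * (norm (F (Suc t) x) - norm (F t x)))"
    by (rule sum.swap)
  also have "\<dots> \<le> (\<Sum>x\<in>X. (norm (F N x))\<^sup>2 - (m N x)\<^sup>2 / 4)"
  proof (rule sum_mono)
    fix x
    have "(\<Sum>t<N. m t x * (norm (F (Suc t) x) - norm (F t x))) \<le> m N x * norm (F N x) - (m N x)\<^sup>2 / 2"
      unfolding m_def by (rule runmax_pathwise)
    also have "\<dots> \<le> (norm (F N x))\<^sup>2 - (m N x)\<^sup>2 / 4"
      using zero_le_power2[of "m N x / 2 - norm (F N x)"] by (simp add: power2_eq_square algebra_simps)
    finally show "(\<Sum>t<N. m t x * (norm (F (Suc t) x) - norm (F t x))) \<le> (norm (F N x))\<^sup>2 - (m N x)\<^sup>2 / 4" .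
  qed
  also have "\<dots> = (\<Sum>x\<in>X. (norm (F N x))\<^sup>2) - (\<Sum>x\<in>X. (m N x)\<^sup>2) / 4"
    by (simp add: sum_subtractf sum_divide_distrib)
  finally show ?thesis by (simp add: m_def)
qed

text \<open>Summing \<open>jump_track_sum_squares\<close> over X kills the cross term, since the
  track at time t is adapted. The bound is the same for every \<epsilon>, so the weights alone
  control the sum over scales in \<open>Lepingle\<close>.\<close>

lemma jump_track_energy:
  "(\<Sum>x\<in>X. \<Sum>t<N. (norm (jump_track \<epsilon> (\<lambda>t. F t x) (Suc t) - jump_track \<epsilon> (\<lambda>t. F t x) t))\<^sup>2)
    \<le> (\<Sum>x\<in>X. (norm (F N x))\<^sup>2)"
proof -
  define g where "g t x = jump_track \<epsilon> (\<lambda>t. F t x) t" for t x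
  have "(\<Sum>x\<in>X. \<Sum>t<N. cnj (g t x) * (F (Suc t) x - F t x))
      = (\<Sum>t<N. \<Sum>x\<in>X. cnj (g t x) * (F (Suc t) x - F t x))" by (rule sum.swap)
  also have "\<dots> = 0"
    by (intro sum.neutral ballI martingale) (auto simp: g_def adapted_jump_track)
  finally have zero: "(\<Sum>x\<in>X. Re (\<Sum>t<N. cnj (g t x) * (F (Suc t) x - F t x))) = 0"
    by (metis Re_sum zero_complex.simps(1))
  have "(\<Sum>x\<in>X. \<Sum>t<N. (norm (g (Suc t) x - g t x))\<^sup>2) \<le>
    (\<Sum>x\<in>X. (norm (F N x))\<^sup>2 - 2 * Re (\<Sum>t<N. cnj (g t x) * (F (Suc t) x - F t x)))"
  proof (rule sum_mono)
    fix x
    show "(\<Sum>t<N. (norm (g (Suc t) x - g t x))\<^sup>2) \<le>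
      (norm (F N x))\<^sup>2 - 2 * Re (\<Sum>t<N. cnj (g t x) * (F (Suc t) x - F t x))"
      using jump_track_sum_squares[of "\<lambda>t. F t x" N \<epsilon>]
        zero_le_power2[of "norm (F N x - g N x)"] zero_le_power2[of "norm (F 0 x)"]
      unfolding g_def by linarith
  qed
  also have "\<dots> = (\<Sum>x\<in>X. (norm (F N x))\<^sup>2)"
    using zero by (simp add: sum_subtractf sum_distrib_left[symmetric])
  finally show ?thesis by (simp add: g_def)
qed

text \<open>The pathwise bound holds for every monotone sequence, so \<open>\<kappa>\<close> and
  \<open>J\<close> may depend on x in any way; one cut-off serves all points because X is finite. In
  the constant, 4 comes from Doob's inequality and 1/(1 - (1/2)^(r-2)) from summing the energies
  over the scales.\<close>

lemma Lepingle:
  assumes r: "2 < r" and \<kappa>: "\<And>x. x \<in> X \<Longrightarrow> mono (\<kappa> x)" "\<And>x. x \<in> X \<Longrightarrow> \<kappa> x (J x) \<le> N"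
  shows "(\<Sum>x\<in>X. (osc r (\<lambda>t. F t x) (\<kappa> x) (J x))\<^sup>2) \<le>
    (64 * 4 powr (r - 2)) powr (2 / r) * (4 + 1 / (1 - (1 / 2) powr (r - 2)))
      * (\<Sum>x\<in>X. (norm (F N x))\<^sup>2)"
proof -
  define K where "K = (64 * 4 powr (r - 2)) powr (2 / r)"
  define \<theta> where "\<theta> = (1 / 2 :: real) powr (r - 2)"
  define Q where "Q = (\<Sum>x\<in>X. (norm (F N x))\<^sup>2)"
  have Q: "0 \<le> Q" by (auto simp: Q_def intro: sum_nonneg)
  have \<theta>: "0 < \<theta>" "\<theta> < 1" using r powr_less_mono2[of "r - 2" "1 / 2" 1] by (auto simp: \<theta>_def)
  have "\<forall>\<^sub>F L in sequentially. \<forall>x\<in>X. (osc r (\<lambda>t. F t x) (\<kappa> x) (J x))\<^sup>2 \<le>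
      K * ((runmax (\<lambda>t. F t x) N)\<^sup>2 + (\<Sum>i<N. jump_energy r L (\<lambda>t. F t x) i))"
    unfolding eventually_ball_finite_distrib[OF finite_X] K_def
    using osc_square_le_jump_energy[OF r \<kappa>] by (auto simp: eventually_sequentially)
  then obtain L where L: "\<And>x. x \<in> X \<Longrightarrow> (osc r (\<lambda>t. F t x) (\<kappa> x) (J x))\<^sup>2 \<le>
      K * ((runmax (\<lambda>t. F t x) N)\<^sup>2 + (\<Sum>i<N. jump_energy r L (\<lambda>t. F t x) i))"
    by (auto simp: eventually_sequentially)
  have "(\<Sum>x\<in>X. \<Sum>i<N. jump_energy r L (\<lambda>t. F t x) i) =
     (\<Sum>m<L. ((1 / 2) ^ Suc m) powr (r - 2) * (\<Sum>x\<in>X. \<Sum>i<N.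
       (norm (jump_track ((1 / 2) ^ Suc m) (\<lambda>t. F t x) (Suc i)
         - jump_track ((1 / 2) ^ Suc m) (\<lambda>t. F t x) i))\<^sup>2))"
    unfolding jump_energy_def sum_distrib_left
    by (rule trans[OF sum.cong[OF refl sum.swap] sum.swap])
  also have "\<dots> \<le> (\<Sum>m<L. ((1 / 2) ^ Suc m) powr (r - 2) * Q)"
    unfolding Q_def by (intro sum_mono mult_left_mono jump_track_energy) auto
  also have "\<dots> \<le> (\<Sum>m<L. \<theta> ^ m) * Q"
  proof -
    have "((1 / 2) ^ Suc m) powr (r - 2) \<le> \<theta> ^ m" for m
    proof -
      have "((1 / 2 :: real) ^ Suc m) powr (r - 2) = \<theta> ^ Suc m"
      proof -
        have "(x ^ i) powr s = (x powr s) ^ i" if "0 \<le> x" for x s :: real and i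
          using that by (induction i) (simp_all add: powr_mult)
        then show ?thesis by (simp only: \<theta>_def)
      qed
      also have "\<dots> \<le> \<theta> ^ m" using \<theta> by (intro power_decreasing) auto
      finally show ?thesis .
    qed
    then show ?thesis unfolding sum_distrib_right using Q by (intro sum_mono mult_right_mono)
  qed
  also have "(\<Sum>m<L. \<theta> ^ m) \<le> 1 / (1 - \<theta>)"
  proof -
    have "(\<Sum>m<L. \<theta> ^ m) = (1 - \<theta> ^ L) / (1 - \<theta>)"
      using \<theta> by (simp add: sum_gp_strict)
    also have "\<dots> \<le> 1 / (1 - \<theta>)" using \<theta> by (intro divide_right_mono) auto
    finally show ?thesis .
  qed
  finally have T: "(\<Sum>x\<in>X. \<Sum>i<N. jump_energy r L (\<lambda>t. F t x) i) \<le> 1 / (1 - \<theta>) * Q"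
    using Q by (simp add: mult_right_mono)
  have "(\<Sum>x\<in>X. (osc r (\<lambda>t. F t x) (\<kappa> x) (J x))\<^sup>2) \<le> (\<Sum>x\<in>X.
      K * ((runmax (\<lambda>t. F t x) N)\<^sup>2 + (\<Sum>i<N. jump_energy r L (\<lambda>t. F t x) i)))"
    by (intro sum_mono L)
  also have "\<dots> = K * ((\<Sum>x\<in>X. (runmax (\<lambda>t. F t x) N)\<^sup>2)
      + (\<Sum>x\<in>X. \<Sum>i<N. jump_energy r L (\<lambda>t. F t x) i))"
    by (simp add: sum_distrib_left[symmetric] sum.distrib)
  also have "\<dots> \<le> K * (4 * Q + 1 / (1 - \<theta>) * Q)"
    using Doob_maximal T by (intro mult_left_mono add_mono) (auto simp: Q_def K_def)
  also have "\<dots> = K * (4 + 1 / (1 - \<theta>)) * Q" by (simp only: distrib_right mult.assoc)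
  finally show ?thesis by (simp add: K_def \<theta>_def Q_def)
qed

end

section \<open>Fourier analysis on the hypercube\<close>

lemma finite_hypercube [simp]: "finite (hypercube n)"
  by (simp add: hypercube_def finite_PiE)

lemma hypercube_coord: "x \<in> hypercube n \<Longrightarrow> j \<in> {1..n} \<Longrightarrow> x j = 0 \<or> x j = 1"
  by (auto simp: hypercube_def dest!: PiE_mem)

lemma hypercube_eqI: "x \<in> hypercube n \<Longrightarrow> y \<in> hypercube n \<Longrightarrow> (\<And>j. j \<in> {1..n} \<Longrightarrow> x j = y j) \<Longrightarrow> x = y"
  unfolding hypercube_def by (rule PiE_ext)

definition cube_char :: "nat \<Rightarrow> (nat \<Rightarrow> nat) \<Rightarrow> (nat \<Rightarrow> nat) \<Rightarrow> real" where
  "cube_char n y x = (-1) ^ cube_dot n x y"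

lemma cube_char_prod: "cube_char n y x = (\<Prod>j=1..n. (-1) ^ (x j * y j))"
  by (simp add: cube_char_def cube_dot_def power_sum)

lemma cube_char_commute: "cube_char n y x = cube_char n x y"
  by (simp add: cube_char_def cube_dot_def mult.commute)

lemma cube_char_orthogonal:
  assumes "y \<in> hypercube n" "z \<in> hypercube n"
  shows "(\<Sum>x\<in>hypercube n. cube_char n y x * cube_char n z x) = (if y = z then 2 ^ n else 0)"
proof -
  have "(\<Sum>x\<in>hypercube n. cube_char n y x * cube_char n z x) =
      (\<Sum>x\<in>{1..n} \<rightarrow>\<^sub>E {0, 1}. \<Prod>j=1..n. (-1) ^ (x j * y j) * (-1) ^ (x j * z j))"
    unfolding hypercube_def cube_char_prod prod.distrib ..
  also have "\<dots> = (\<Prod>j=1..n. \<Sum>b\<in>{0, 1}. (-1) ^ (b * y j) * (-1) ^ (b * z j))"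
    by (rule prod_sum_PiE[symmetric]) auto
  also have "\<dots> = (\<Prod>j=1..n. if y j = z j then 2 else 0)"
  proof (rule prod.cong[OF refl])
    fix j assume "j \<in> {1..n}"
    then show "(\<Sum>b\<in>{0, 1}. (-1) ^ (b * y j) * (-1) ^ (b * z j)) = (if y j = z j then 2 else (0 :: real))"
      using hypercube_coord[OF assms(1)] hypercube_coord[OF assms(2)] by fastforce
  qed
  also have "\<dots> = (if y = z then 2 ^ n else 0)"
  proof (cases "y = z")
    case False
    then obtain j where "j \<in> {1..n}" "y j \<noteq> z j" using hypercube_eqI[OF assms] by blast
    then show ?thesis using False by (auto intro!: bexI[of _ j])
  qed simp
  finally show ?thesis .
qed

definition cube_synth :: "nat \<Rightarrow> ((nat \<Rightarrow> nat) \<Rightarrow> complex) \<Rightarrow> (nat \<Rightarrow> nat) \<Rightarrow> complex" where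
  "cube_synth n c x = 1 / complex_of_real (sqrt (2 ^ n)) *
     (\<Sum>y\<in>hypercube n. c y * complex_of_real (cube_char n y x))"

lemma cube_fourier_char:
  "cube_fourier n f y = 1 / complex_of_real (sqrt (2 ^ n)) *
     (\<Sum>x\<in>hypercube n. f x * complex_of_real (cube_char n y x))"
  by (simp add: cube_fourier_def cube_char_def)

lemma sqrt_power_square: "complex_of_real (sqrt (2 ^ n)) * complex_of_real (sqrt (2 ^ n)) = 2 ^ n"
  by (simp add: of_real_mult[symmetric] del: of_real_mult)

lemma cube_inversion:
  assumes x: "x \<in> hypercube n"
  shows "cube_synth n (cube_fourier n f) x = f x"
proof -
  let ?s = "complex_of_real (sqrt (2 ^ n))"
  have "cube_synth n (cube_fourier n f) x = 1 / (?s * ?s) * (\<Sum>y\<in>hypercube n. \<Sum>z\<in>hypercube n.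
      f z * complex_of_real (cube_char n z y * cube_char n x y))"
    unfolding cube_synth_def cube_fourier_char
    by (simp add: sum_distrib_left sum_distrib_right mult_ac cube_char_commute[of n z for z] cong: sum.cong)
  also have "(\<Sum>y\<in>hypercube n. \<Sum>z\<in>hypercube n. f z * complex_of_real (cube_char n z y * cube_char n x y))
     = (\<Sum>z\<in>hypercube n. \<Sum>y\<in>hypercube n. f z * complex_of_real (cube_char n z y * cube_char n x y))"
    by (rule sum.swap)
  also have "\<dots> = (\<Sum>z\<in>hypercube n. f z * complex_of_real (if z = x then 2 ^ n else 0))"
  proof (rule sum.cong[OF refl])
    fix z assume "z \<in> hypercube n"
    then show "(\<Sum>y\<in>hypercube n. f z * complex_of_real (cube_char n z y * cube_char n x y))
      = f z * complex_of_real (if z = x then 2 ^ n else 0)"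
      by (simp only: sum_distrib_left[symmetric] of_real_sum[symmetric] cube_char_orthogonal x)
  qed
  also have "\<dots> = (\<Sum>z\<in>hypercube n. if z = x then 2 ^ n * f z else 0)"
    by (intro sum.cong) auto
  also have "\<dots> = 2 ^ n * f x" using x by simp
  finally show ?thesis unfolding sqrt_power_square by simp
qed

lemma cube_Plancherel:
  "(\<Sum>x\<in>hypercube n. (norm (cube_synth n c x))\<^sup>2) = (\<Sum>y\<in>hypercube n. (norm (c y))\<^sup>2)"
proof -
  let ?s = "complex_of_real (sqrt (2 ^ n))"
  let ?Q = "hypercube n"
  have "complex_of_real (\<Sum>x\<in>?Q. (norm (cube_synth n c x))\<^sup>2)
     = (\<Sum>x\<in>?Q. cube_synth n c x * cnj (cube_synth n c x))"
    by (simp add: complex_norm_square del: of_real_power)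
  also have "\<dots> = (\<Sum>x\<in>?Q. 1 / (?s * ?s) * (\<Sum>y\<in>?Q. \<Sum>z\<in>?Q. c y * cnj (c z) *
      complex_of_real (cube_char n y x * cube_char n z x)))"
  proof (rule sum.cong[OF refl])
    fix x
    have "cnj (cube_synth n c x) = 1 / ?s * (\<Sum>z\<in>?Q. cnj (c z) * complex_of_real (cube_char n z x))"
      by (simp add: cube_synth_def)
    then have "cube_synth n c x * cnj (cube_synth n c x) = 1 / (?s * ?s) *
       ((\<Sum>y\<in>?Q. c y * complex_of_real (cube_char n y x)) *
        (\<Sum>z\<in>?Q. cnj (c z) * complex_of_real (cube_char n z x)))"
      by (simp add: cube_synth_def)
    also have "\<dots> = 1 / (?s * ?s) * (\<Sum>y\<in>?Q. \<Sum>z\<in>?Q. c y * cnj (c z) *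
      complex_of_real (cube_char n y x * cube_char n z x))"
      unfolding sum_product of_real_mult by (simp only: mult_ac)
    finally show "cube_synth n c x * cnj (cube_synth n c x) =
      1 / (?s * ?s) * (\<Sum>y\<in>?Q. \<Sum>z\<in>?Q. c y * cnj (c z) *
      complex_of_real (cube_char n y x * cube_char n z x))" .
  qed
  also have "\<dots> = 1 / (?s * ?s) * (\<Sum>x\<in>?Q. \<Sum>y\<in>?Q. \<Sum>z\<in>?Q. c y * cnj (c z) *
      complex_of_real (cube_char n y x * cube_char n z x))"
    by (simp only: sum_distrib_left)
  also have "(\<Sum>x\<in>?Q. \<Sum>y\<in>?Q. \<Sum>z\<in>?Q. c y * cnj (c z) *
      complex_of_real (cube_char n y x * cube_char n z x)) =
      (\<Sum>y\<in>?Q. \<Sum>z\<in>?Q. \<Sum>x\<in>?Q. c y * cnj (c z) *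
      complex_of_real (cube_char n y x * cube_char n z x))"
    by (rule trans[OF sum.swap sum.cong[OF refl sum.swap]])
  also have "\<dots> = (\<Sum>y\<in>?Q. \<Sum>z\<in>?Q. c y * cnj (c z) * complex_of_real (if y = z then 2 ^ n else 0))"
    by (intro sum.cong refl)
      (simp only: sum_distrib_left[symmetric] of_real_sum[symmetric] cube_char_orthogonal)
  also have "\<dots> = (\<Sum>y\<in>?Q. \<Sum>z\<in>?Q. if y = z then 2 ^ n * (c y * cnj (c z)) else 0)"
    by (intro sum.cong) auto
  also have "\<dots> = 2 ^ n * (\<Sum>y\<in>?Q. c y * cnj (c y))"
    by (simp add: sum_distrib_left)
  also have "1 / (?s * ?s) * (2 ^ n * (\<Sum>y\<in>?Q. c y * cnj (c y))) = (\<Sum>y\<in>?Q. c y * cnj (c y))"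
    unfolding sqrt_power_square by simp
  also have "\<dots> = complex_of_real (\<Sum>y\<in>?Q. (norm (c y))\<^sup>2)"
    by (simp add: complex_norm_square del: of_real_power)
  finally show ?thesis using of_real_eq_iff by blast
qed

section \<open>Fourier multipliers and the symbol of the spherical means\<close>

definition fourier_mult ::
    "nat \<Rightarrow> ((nat \<Rightarrow> nat) \<Rightarrow> real) \<Rightarrow> ((nat \<Rightarrow> nat) \<Rightarrow> complex) \<Rightarrow> (nat \<Rightarrow> nat) \<Rightarrow> complex" where
  "fourier_mult n m f = cube_synth n (\<lambda>y. complex_of_real (m y) * cube_fourier n f y)"

lemma fourier_mult_one: "x \<in> hypercube n \<Longrightarrow> fourier_mult n (\<lambda>y. 1) f x = f x"
  by (simp add: fourier_mult_def cube_inversion)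

lemma fourier_mult_cong:
  "(\<And>y. y \<in> hypercube n \<Longrightarrow> m y = m' y) \<Longrightarrow> fourier_mult n m f x = fourier_mult n m' f x"
  by (simp add: fourier_mult_def cube_synth_def)

lemma fourier_mult_add:
  "fourier_mult n (\<lambda>y. m y + m' y) f x = fourier_mult n m f x + fourier_mult n m' f x"
  by (simp add: fourier_mult_def cube_synth_def algebra_simps sum.distrib)

lemma fourier_mult_diff:
  "fourier_mult n (\<lambda>y. m y - m' y) f x = fourier_mult n m f x - fourier_mult n m' f x"
  by (simp add: fourier_mult_def cube_synth_def algebra_simps sum_subtractf)

lemma fourier_mult_sum:
  assumes "finite I"
  shows "fourier_mult n (\<lambda>y. \<Sum>i\<in>I. m i y) f x = (\<Sum>i\<in>I. fourier_mult n (m i) f x)"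
  using assms by (induction I) (simp_all add: fourier_mult_add, simp add: fourier_mult_def cube_synth_def)

lemma fourier_mult_scale:
  "fourier_mult n (\<lambda>y. c * m y) f x = complex_of_real c * fourier_mult n m f x"
  by (simp add: fourier_mult_def cube_synth_def sum_distrib_left mult_ac)

lemma fourier_mult_Plancherel:
  "(\<Sum>x\<in>hypercube n. (norm (fourier_mult n m f x))\<^sup>2) =
   (\<Sum>y\<in>hypercube n. (m y)\<^sup>2 * (norm (cube_fourier n f y))\<^sup>2)"
  by (simp add: fourier_mult_def cube_Plancherel norm_mult power_mult_distrib)

lemma cube_fourier_Plancherel:
  "(\<Sum>y\<in>hypercube n. (norm (cube_fourier n f y))\<^sup>2) = (\<Sum>x\<in>hypercube n. (norm (f x))\<^sup>2)"
  using cube_Plancherel[of n "cube_fourier n f"] by (simp add: cube_inversion)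

lemma weight_card:
  assumes "y \<in> hypercube n"
  shows "weight n y = card {j \<in> {1..n}. y j \<noteq> 0}"
proof -
  have "weight n y = (\<Sum>j=1..n. if y j \<noteq> 0 then 1 else 0)"
    unfolding weight_def using hypercube_coord[OF assms] by (intro sum.cong) fastforce+
  then show ?thesis by (simp add: sum.If_cases Int_def)
qed

lemma weight_le: "y \<in> hypercube n \<Longrightarrow> weight n y \<le> n"
  unfolding weight_card by (rule order_trans[OF card_mono[of "{1..n}"]]) auto

lemma prod_by_coord:
  fixes a b :: "'a :: comm_monoid_mult"
  assumes "y \<in> hypercube n"
  shows "(\<Prod>j=1..n. if y j \<noteq> 0 then a else b) = a ^ weight n y * b ^ (n - weight n y)"
proof -
  let ?B = "{j \<in> {1..n}. y j \<noteq> 0}"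
  have "{j \<in> {1..n}. y j = 0} = {1..n} - ?B" by auto
  moreover have "card ({1..n} - ?B) = card {1..n} - card ?B" by (rule card_Diff_subset) auto
  ultimately have "card {j \<in> {1..n}. y j = 0} = n - weight n y"
    using weight_card[OF assms] by (simp only: card_atLeastAtMost diff_Suc_1)
  then show ?thesis using weight_card[OF assms] by (simp add: prod.If_cases Int_def)
qed

text \<open>With X marking the distance from x, the sum over all z factors over the coordinates. A
  coordinate with y_j = 0 contributes 1 + X, one with y_j = 1 contributes (-1)^(x_j) (1 - X); the
  product is the character at x times \<open>kraw_poly\<close>.\<close>

lemma sphere_sum_char:
  assumes x: "x \<in> hypercube n" and y: "y \<in> hypercube n"
  shows "(\<Sum>z | z \<in> hypercube n \<and> hamming_dist n x z = k. cube_char n y z)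
    = coeff (kraw_poly n (weight n y)) k * cube_char n y x"
proof -
  define X where "X = [:0, 1 :: real:]"
  have m: "monom 1 i = X ^ i" for i by (simp add: X_def monom_altdef)
  have d: "hamming_dist n x z = (\<Sum>j=1..n. if x j \<noteq> z j then 1 else 0)" for z
    by (simp add: hamming_dist_def sum.If_cases Int_def)
  have pc: "[:\<Prod>j\<in>A. g j:] = (\<Prod>j\<in>A. [:g j:])" if "finite A" for A :: "nat set" and g :: "nat \<Rightarrow> real"
    using that
  proof (induction A)
    case (insert i A)
    have "[:g i * prod g A:] = [:g i:] * [:prod g A:]" by simp
    then show ?case by (simp only: prod.insert[OF insert.hyps] insert.IH[symmetric])
  qed (simp add: one_pCons)
  have "(\<Sum>z\<in>hypercube n. [:cube_char n y z:] * monom 1 (hamming_dist n x z)) =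
     (\<Sum>z\<in>{1..n} \<rightarrow>\<^sub>E {0, 1}. \<Prod>j=1..n. [:(-1) ^ (z j * y j):] * X ^ (if x j \<noteq> z j then 1 else 0))"
    unfolding m d hypercube_def cube_char_prod power_sum prod.distrib pc[OF finite_atLeastAtMost] ..
  also have "\<dots> = (\<Prod>j=1..n. \<Sum>b\<in>{0, 1}. [:(-1) ^ (b * y j):] * X ^ (if x j \<noteq> b then 1 else 0))"
    by (rule prod_sum_PiE[symmetric]) auto
  also have "\<dots> = (\<Prod>j=1..n. [:(-1) ^ (x j * y j):] * (if y j \<noteq> 0 then [:1, -1:] else [:1, 1:]))"
  proof (rule prod.cong[OF refl])
    fix j assume "j \<in> {1..n}"
    then have "x j = 0 \<or> x j = 1" "y j = 0 \<or> y j = 1" using hypercube_coord x y by auto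
    then show "(\<Sum>b\<in>{0, 1}. [:(-1) ^ (b * y j):] * X ^ (if x j \<noteq> b then 1 else 0)) =
      [:(-1) ^ (x j * y j):] * (if y j \<noteq> 0 then [:1, -1:] else [:1, 1:])"
      by (auto simp: X_def one_pCons)
  qed
  also have "\<dots> = [:cube_char n y x:] * kraw_poly n (weight n y)"
    unfolding prod.distrib prod_by_coord[OF y] cube_char_prod pc[OF finite_atLeastAtMost] kraw_poly_def ..
  finally have eq: "(\<Sum>z\<in>hypercube n. [:cube_char n y z:] * monom 1 (hamming_dist n x z))
    = [:cube_char n y x:] * kraw_poly n (weight n y)" .
  have "(\<Sum>z | z \<in> hypercube n \<and> hamming_dist n x z = k. cube_char n y z)
    = (\<Sum>z\<in>hypercube n. if hamming_dist n x z = k then cube_char n y z else 0)"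
    by (simp add: sum.If_cases Int_def)
  also have "\<dots> = coeff (\<Sum>z\<in>hypercube n. [:cube_char n y z:] * monom 1 (hamming_dist n x z)) k"
    by (simp add: coeff_sum smult_monom)
  finally show ?thesis unfolding eq by simp
qed

lemma spherical_mean_mult:
  assumes x: "x \<in> hypercube n"
  shows "spherical_mean n k f x = fourier_mult n (\<lambda>y. kraw n k (weight n y)) f x"
proof -
  let ?s = "complex_of_real (sqrt (2 ^ n))"
  let ?S = "{z. z \<in> hypercube n \<and> hamming_dist n x z = k}"
  have "(\<Sum>z\<in>?S. f z) = (\<Sum>z\<in>?S. cube_synth n (cube_fourier n f) z)"
    by (intro sum.cong) (auto simp: cube_inversion)
  also have "\<dots> = 1 / ?s * (\<Sum>z\<in>?S. \<Sum>y\<in>hypercube n. cube_fourier n f y * complex_of_real (cube_char n y z))"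
    by (simp add: cube_synth_def sum_distrib_left)
  also have "(\<Sum>z\<in>?S. \<Sum>y\<in>hypercube n. cube_fourier n f y * complex_of_real (cube_char n y z))
     = (\<Sum>y\<in>hypercube n. \<Sum>z\<in>?S. cube_fourier n f y * complex_of_real (cube_char n y z))"
    by (rule sum.swap)
  also have "\<dots> = (\<Sum>y\<in>hypercube n. cube_fourier n f y *
      complex_of_real (coeff (kraw_poly n (weight n y)) k * cube_char n y x))"
    by (intro sum.cong refl)
      (simp only: sum_distrib_left[symmetric] of_real_sum[symmetric] sphere_sum_char[OF x])
  finally have "spherical_mean n k f x = 1 / of_nat (n choose k) * (1 / ?s *
     (\<Sum>y\<in>hypercube n. cube_fourier n f y *
      complex_of_real (coeff (kraw_poly n (weight n y)) k * cube_char n y x)))"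
    by (simp add: spherical_mean_def)
  also have "\<dots> = fourier_mult n (\<lambda>y. kraw n k (weight n y)) f x"
    by (simp add: fourier_mult_def cube_synth_def kraw_def sum_distrib_left sum_divide_distrib mult_ac)
  finally show ?thesis .
qed

section \<open>Restriction to random sets of coordinates\<close>

definition supp_ind :: "nat \<Rightarrow> nat set \<Rightarrow> (nat \<Rightarrow> nat) \<Rightarrow> real" where
  "supp_ind n A y = of_bool (\<forall>j\<in>{1..n}. y j \<noteq> 0 \<longrightarrow> j \<in> A)"

lemma cube_char_agree:
  assumes "supp_ind n A y \<noteq> 0" "\<And>j. j \<in> {1..n} \<Longrightarrow> j \<in> A \<Longrightarrow> x j = x' j"
  shows "cube_char n y x = cube_char n y x'"
  unfolding cube_char_prod
proof (rule prod.cong[OF refl])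
  fix j assume "j \<in> {1..n}"
  then have "y j = 0 \<or> j \<in> A" using assms(1) by (auto simp: supp_ind_def)
  then show "(-1) ^ (x j * y j) = (-1 :: real) ^ (x' j * y j)"
    using assms(2)[OF \<open>j \<in> {1..n}\<close>] by auto
qed

text \<open>Flipping the i-th coordinate is an involution of the cube that keeps \<open>G\<close>
  and negates the character.\<close>

lemma sum_mult_cube_char_zero:
  assumes i: "i \<in> {1..n}" "y i = 1"
    and G: "\<And>x x'. x \<in> hypercube n \<Longrightarrow> x' \<in> hypercube n \<Longrightarrow> (\<And>j. j \<in> {1..n} \<Longrightarrow> j \<noteq> i \<Longrightarrow> x j = x' j) \<Longrightarrow> G x = G x'"
  shows "(\<Sum>x\<in>hypercube n. G x * complex_of_real (cube_char n y x)) = 0"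
proof -
  define fl where "fl x = x(i := 1 - x i)" for x :: "nat \<Rightarrow> nat"
  have fl: "fl x \<in> hypercube n" if "x \<in> hypercube n" for x
    using that i(1) by (auto simp: fl_def hypercube_def PiE_iff extensional_def)
  have ff: "fl (fl x) = x" if "x \<in> hypercube n" for x
    using hypercube_coord[OF that i(1)] by (auto simp: fl_def)
  have "cube_char n y (fl x) = - cube_char n y x" if x: "x \<in> hypercube n" for x
  proof -
    have "(\<Prod>j\<in>{1..n} - {i}. (-1 :: real) ^ (fl x j * y j)) = (\<Prod>j\<in>{1..n} - {i}. (-1) ^ (x j * y j))"
      by (intro prod.cong) (auto simp: fl_def)
    moreover have "(-1 :: real) ^ (fl x i * y i) = - ((-1) ^ (x i * y i))"
      using hypercube_coord[OF x i(1)] i(2) by (auto simp: fl_def)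
    ultimately show ?thesis
      unfolding cube_char_prod prod.remove[OF finite_atLeastAtMost i(1)] by simp
  qed
  moreover have "G (fl x) = G x" if "x \<in> hypercube n" for x
    using that by (intro G fl) (auto simp: fl_def)
  ultimately have "(\<Sum>x\<in>hypercube n. G x * complex_of_real (cube_char n y x)) =
      (\<Sum>x\<in>hypercube n. - (G x * complex_of_real (cube_char n y x)))"
    by (intro sum.reindex_bij_witness[where i = fl and j = fl]) (auto simp: fl ff)
  then show ?thesis by (simp add: sum_negf)
qed

text \<open>\<open>fourier_mult n (supp_ind n A) f\<close> is the conditional expectation of \<open>f\<close> given the coordinates in
  \<open>A\<close>. Time runs backwards in the label threshold \<open>n - t\<close>.\<close>

lemma restriction_martingale:
  "finite_martingale (hypercube n) (\<lambda>t x y. \<forall>j\<in>{1..n}. n - t \<le> \<omega> j \<longrightarrow> x j = y j)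
    (\<lambda>t. fourier_mult n (supp_ind n {j. n - t \<le> \<omega> j}) f) n"
proof
  let ?R = "\<lambda>t (x :: nat \<Rightarrow> nat) y. \<forall>j\<in>{1..n}. n - t \<le> \<omega> j \<longrightarrow> x j = y j"
  show "?R (Suc t) x y \<Longrightarrow> ?R t x y" for t x y by force
  show "fourier_mult n (supp_ind n {j. n - t \<le> \<omega> j}) f x = fourier_mult n (supp_ind n {j. n - t \<le> \<omega> j}) f y"
    if "?R t x y" for t x y
  proof -
    have "complex_of_real (supp_ind n {j. n - t \<le> \<omega> j} z) * c * complex_of_real (cube_char n z x)
      = complex_of_real (supp_ind n {j. n - t \<le> \<omega> j} z) * c * complex_of_real (cube_char n z y)" for z c
    proof (cases "supp_ind n {j. n - t \<le> \<omega> j} z = 0")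
      case False
      then have "cube_char n z x = cube_char n z y"
        using that by (intro cube_char_agree[where A = "{j. n - t \<le> \<omega> j}"]) auto
      then show ?thesis by simp
    qed simp
    then show ?thesis unfolding fourier_mult_def cube_synth_def by (simp only:)
  qed
  show "(\<Sum>x\<in>hypercube n. G x * (fourier_mult n (supp_ind n {j. n - Suc t \<le> \<omega> j}) f x
      - fourier_mult n (supp_ind n {j. n - t \<le> \<omega> j}) f x)) = 0"
    if t: "t < n" and G: "\<And>x y. x \<in> hypercube n \<Longrightarrow> y \<in> hypercube n \<Longrightarrow> ?R t x y \<Longrightarrow> G x = G y" for t G
  proof -
    define m where "m y = supp_ind n {j. n - Suc t \<le> \<omega> j} y - supp_ind n {j. n - t \<le> \<omega> j} y" for y
    let ?s = "complex_of_real (sqrt (2 ^ n))"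
    have "(\<Sum>x\<in>hypercube n. G x * fourier_mult n m f x) =
      (\<Sum>x\<in>hypercube n. \<Sum>y\<in>hypercube n. 1 / ?s * cube_fourier n f y *
         (complex_of_real (m y) * (G x * complex_of_real (cube_char n y x))))"
      by (simp add: fourier_mult_def cube_synth_def sum_distrib_left mult_ac)
    also have "\<dots> = (\<Sum>y\<in>hypercube n. \<Sum>x\<in>hypercube n. 1 / ?s * cube_fourier n f y *
         (complex_of_real (m y) * (G x * complex_of_real (cube_char n y x))))"
      by (rule sum.swap)
    also have "\<dots> = (\<Sum>y\<in>hypercube n. 1 / ?s * cube_fourier n f y *
         (complex_of_real (m y) * (\<Sum>x\<in>hypercube n. G x * complex_of_real (cube_char n y x))))"
      by (simp only: sum_distrib_left)
    also have "\<dots> = 0"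
    proof (rule sum.neutral, rule ballI)
      fix y assume y: "y \<in> hypercube n"
      \<comment> \<open>\<open>G\<close> is blind to coordinates of label below n - t, so a nonzero
        sum forces the support of y into labels at least n - t; then y passes both restrictions and
        \<open>m y\<close> is a difference of equal values.\<close>
      have "m y = 0 \<or> (\<Sum>x\<in>hypercube n. G x * complex_of_real (cube_char n y x)) = 0"
      proof (rule disjCI)
        assume nz: "(\<Sum>x\<in>hypercube n. G x * complex_of_real (cube_char n y x)) \<noteq> 0"
        have "n - t \<le> \<omega> i" if i: "i \<in> {1..n}" "y i \<noteq> 0" for i
        proof (rule ccontr)
          assume "\<not> n - t \<le> \<omega> i"
          then have "(\<Sum>x\<in>hypercube n. G x * complex_of_real (cube_char n y x)) = 0"
          proof (intro sum_mult_cube_char_zero[OF i(1)])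
            show "y i = 1" using hypercube_coord[OF y i(1)] i(2) by auto
            fix x x' assume x: "x \<in> hypercube n" "x' \<in> hypercube n"
              and agree: "\<And>j. j \<in> {1..n} \<Longrightarrow> j \<noteq> i \<Longrightarrow> x j = x' j"
            have "?R t x x'"
            proof (intro ballI impI)
              fix j assume "j \<in> {1..n}" "n - t \<le> \<omega> j"
              then show "x j = x' j" using agree \<open>\<not> n - t \<le> \<omega> i\<close> by blast
            qed
            then show "G x = G x'" by (rule G[OF x])
          qed
          then show False using nz by simp
        qed
        then show "m y = 0" by (fastforce simp: m_def supp_ind_def)
      qed
      then show "1 / ?s * cube_fourier n f y *
         (complex_of_real (m y) * (\<Sum>x\<in>hypercube n. G x * complex_of_real (cube_char n y x))) = 0"
        by auto
    qed
    finally show ?thesis unfolding m_def fourier_mult_diff .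
  qed
qed simp

text \<open>For a uniformly random labelling, the labels on the support of y are independent and
  each is at least k with probability 1 - k/n. With n possible labels the thresholds 0, ..., n match
  the radii exactly.\<close>

lemma average_supp_ind:
  assumes y: "y \<in> hypercube n" and n: "1 \<le> n" and k: "k \<le> n"
  shows "(\<Sum>\<omega>\<in>{1..n} \<rightarrow>\<^sub>E {..<n}. supp_ind n {j. k \<le> \<omega> j} y) = real n ^ n * (1 - real k / n) ^ weight n y"
proof -
  have "supp_ind n {j. k \<le> \<omega> j} y = (\<Prod>j=1..n. if y j \<noteq> 0 then of_bool (k \<le> \<omega> j) else 1)" for \<omega>
  proof (cases "\<forall>j\<in>{1..n}. y j \<noteq> 0 \<longrightarrow> k \<le> \<omega> j")
    case True
    then have "(\<Prod>j=1..n. if y j \<noteq> 0 then of_bool (k \<le> \<omega> j) else 1 :: real) = 1"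
      by (intro prod.neutral) auto
    then show ?thesis using True by (simp add: supp_ind_def)
  next
    case False
    then obtain j where "j \<in> {1..n}" "y j \<noteq> 0" "\<not> k \<le> \<omega> j" by blast
    then have "(\<Prod>j=1..n. if y j \<noteq> 0 then of_bool (k \<le> \<omega> j) else 1 :: real) = 0"
      by (intro prod_zero) (auto intro!: bexI[of _ j])
    then show ?thesis using False by (auto simp: supp_ind_def)
  qed
  then have "(\<Sum>\<omega>\<in>{1..n} \<rightarrow>\<^sub>E {..<n}. supp_ind n {j. k \<le> \<omega> j} y) =
     (\<Sum>\<omega>\<in>{1..n} \<rightarrow>\<^sub>E {..<n}. \<Prod>j=1..n. if y j \<noteq> 0 then of_bool (k \<le> \<omega> j) else 1)" by simp
  also have "\<dots> = (\<Prod>j=1..n. \<Sum>b<n. if y j \<noteq> 0 then of_bool (k \<le> b) else 1)"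
    by (rule prod_sum_PiE[symmetric]) auto
  also have "\<dots> = (\<Prod>j=1..n. if y j \<noteq> 0 then real n - real k else real n)"
  proof (rule prod.cong[OF refl])
    fix j
    have "{..<n} \<inter> {b. k \<le> b} = {k..<n}" by auto
    then have "(\<Sum>b<n. of_bool (k \<le> b) :: real) = real n - real k" using k by (simp add: of_nat_diff)
    then show "(\<Sum>b<n. if y j \<noteq> 0 then of_bool (k \<le> b) else 1) = (if y j \<noteq> 0 then real n - real k else real n)"
      by simp
  qed
  also have "\<dots> = (real n - real k) ^ weight n y * real n ^ (n - weight n y)"
    by (rule prod_by_coord[OF y])
  also have "real n - real k = real n * (1 - real k / n)" using n by (simp add: field_simps)
  also have "(real n * (1 - real k / n)) ^ weight n y * real n ^ (n - weight n y)
      = (real n ^ weight n y * real n ^ (n - weight n y)) * (1 - real k / n) ^ weight n y"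
    by (simp add: power_mult_distrib mult_ac)
  also have "real n ^ weight n y * real n ^ (n - weight n y) = real n ^ n"
    using weight_le[OF y] by (simp add: power_add[symmetric])
  finally show ?thesis .
qed

lemma smooth_mult_average:
  assumes "1 \<le> n" "k \<le> n"
  shows "fourier_mult n (\<lambda>y. (1 - real k / n) ^ weight n y) f x =
    (\<Sum>\<omega>\<in>{1..n} \<rightarrow>\<^sub>E {..<n}. complex_of_real (1 / real n ^ n) * fourier_mult n (supp_ind n {j. k \<le> \<omega> j}) f x)"
proof -
  have "fourier_mult n (\<lambda>y. (1 - real k / n) ^ weight n y) f x =
    fourier_mult n (\<lambda>y. \<Sum>\<omega>\<in>{1..n} \<rightarrow>\<^sub>E {..<n}. 1 / real n ^ n * supp_ind n {j. k \<le> \<omega> j} y) f x"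
    using assms by (intro fourier_mult_cong)
      (simp only: sum_distrib_left[symmetric] average_supp_ind, simp)
  also have "\<dots> = (\<Sum>\<omega>\<in>{1..n} \<rightarrow>\<^sub>E {..<n}. complex_of_real (1 / real n ^ n) * fourier_mult n (supp_ind n {j. k \<le> \<omega> j}) f x)"
    by (subst fourier_mult_sum) (auto simp only: fourier_mult_scale finite_PiE finite_atLeastAtMost finite_lessThan)
  finally show ?thesis .
qed

section \<open>Variation of spherical means\<close>

lemma L2_set_square: "(L2_set f A)\<^sup>2 = (\<Sum>x\<in>A. (f x)\<^sup>2)"
  by (simp add: L2_set_def sum_nonneg)

lemma L2_set_le_iff:
  assumes "0 \<le> C" "0 \<le> L"
  shows "(\<Sum>x\<in>A. (f x)\<^sup>2) \<le> C * L\<^sup>2 \<longleftrightarrow> L2_set f A \<le> sqrt C * L"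
proof -
  have "sqrt C * L = sqrt (C * L\<^sup>2)" using assms by (simp add: real_sqrt_mult)
  then show ?thesis by (simp add: L2_set_def)
qed

lemma L2_set_sum_le:
  assumes "finite I"
  shows "L2_set (\<lambda>x. \<Sum>i\<in>I. g i x) A \<le> (\<Sum>i\<in>I. L2_set (g i) A)"
  using assms
proof (induction I)
  case (insert i I)
  then show ?case
    using L2_set_triangle_ineq[of "g i" "\<lambda>x. \<Sum>i\<in>I. g i x" A] by simp
qed (simp add: L2_set_0')

lemma L2_set_le_add:
  assumes "\<And>x. x \<in> A \<Longrightarrow> f x \<le> g x + h x" "\<And>x. x \<in> A \<Longrightarrow> 0 \<le> f x"
  shows "L2_set f A \<le> L2_set g A + L2_set h A"
  using L2_set_mono[of A f "\<lambda>x. g x + h x"] L2_set_triangle_ineq[of g h A] assms by fastforce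

text \<open>The right side of \<open>osc_square_le_weighted\<close> no longer involves
  \<open>\<kappa>\<close>, so Plancherel applies to each of its terms. What remains at each
  frequency outside \<open>high_freqs n\<close> is the sum in \<open>mult_diff_square_sum\<close>;
  72000 = 16 * 4500.\<close>

lemma difference_osc_bound:
  assumes r: "2 \<le> r" and n: "2 * h \<le> n"
    and f: "\<And>y. y \<in> high_freqs n \<Longrightarrow> cube_fourier n f y = 0"
    and \<kappa>: "\<And>x. x \<in> hypercube n \<Longrightarrow> mono (\<kappa> x)" "\<And>x. x \<in> hypercube n \<Longrightarrow> \<kappa> x (J x) \<le> h"
  shows "L2_set (\<lambda>x. osc r (\<lambda>k. fourier_mult n (\<lambda>y. mult_diff n k (weight n y)) f x) (\<kappa> x) (J x)) (hypercube n)
    \<le> sqrt 72000 * l2_norm n f"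
proof -
  define D where "D k = fourier_mult n (\<lambda>y. mult_diff n k (weight n y)) f" for k
  let ?Q = "hypercube n"
  have dD: "D (Suc k) x - D k x = fourier_mult n (\<lambda>y. mult_diff n (Suc k) (weight n y) - mult_diff n k (weight n y)) f x" for k x
    by (simp add: D_def fourier_mult_diff)
  have "(\<Sum>x\<in>?Q. (osc r (\<lambda>k. D k x) (\<kappa> x) (J x))\<^sup>2) \<le> (\<Sum>x\<in>?Q. 16 * (\<Sum>k<h.
      (norm (D k x))\<^sup>2 / real (Suc k) + real (Suc k) * (norm (D (Suc k) x - D k x))\<^sup>2))"
    by (intro sum_mono osc_square_le_weighted r \<kappa>)
  also have "\<dots> = 16 * (\<Sum>k<h. \<Sum>x\<in>?Q. (norm (D k x))\<^sup>2 / real (Suc k)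
      + real (Suc k) * (norm (D (Suc k) x - D k x))\<^sup>2)"
    unfolding sum_distrib_left[symmetric] by (subst sum.swap) simp
  also have "\<dots> = 16 * (\<Sum>k<h. \<Sum>y\<in>?Q. ((mult_diff n k (weight n y))\<^sup>2 / real (Suc k)
      + real (Suc k) * (mult_diff n (Suc k) (weight n y) - mult_diff n k (weight n y))\<^sup>2)
      * (norm (cube_fourier n f y))\<^sup>2)"
  proof -
    have "(\<Sum>x\<in>?Q. (norm (D k x))\<^sup>2 / real (Suc k) + real (Suc k) * (norm (D (Suc k) x - D k x))\<^sup>2)
      = (\<Sum>y\<in>?Q. ((mult_diff n k (weight n y))\<^sup>2 / real (Suc k)
      + real (Suc k) * (mult_diff n (Suc k) (weight n y) - mult_diff n k (weight n y))\<^sup>2)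
      * (norm (cube_fourier n f y))\<^sup>2)" for k
      unfolding sum.distrib sum_divide_distrib[symmetric] sum_distrib_left[symmetric] dD
      unfolding D_def fourier_mult_Plancherel sum_divide_distrib sum_distrib_left sum.distrib[symmetric]
      by (intro sum.cong refl) (simp only: distrib_right times_divide_eq_left mult.assoc)
    then show ?thesis by (simp only:)
  qed
  also have "\<dots> = 16 * (\<Sum>y\<in>?Q. \<Sum>k<h. ((mult_diff n k (weight n y))\<^sup>2 / real (Suc k)
      + real (Suc k) * (mult_diff n (Suc k) (weight n y) - mult_diff n k (weight n y))\<^sup>2)
      * (norm (cube_fourier n f y))\<^sup>2)"
    by (subst sum.swap) simp
  also have "\<dots> \<le> 16 * (\<Sum>y\<in>?Q. 4500 * (norm (cube_fourier n f y))\<^sup>2)"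
  proof (intro mult_left_mono sum_mono)
    fix y assume y: "y \<in> ?Q"
    show "(\<Sum>k<h. ((mult_diff n k (weight n y))\<^sup>2 / real (Suc k)
      + real (Suc k) * (mult_diff n (Suc k) (weight n y) - mult_diff n k (weight n y))\<^sup>2)
      * (norm (cube_fourier n f y))\<^sup>2) \<le> 4500 * (norm (cube_fourier n f y))\<^sup>2"
    proof (cases "y \<in> high_freqs n")
      case True
      then show ?thesis using f by simp
    next
      case False
      then have "2 * weight n y \<le> n" using y by (auto simp: high_freqs_def)
      then show ?thesis unfolding sum_distrib_right[symmetric]
        by (intro mult_right_mono mult_diff_square_sum n) auto
    qed
  qed simp
  also have "\<dots> = 72000 * (l2_norm n f)\<^sup>2"
    by (simp add: sum_distrib_left[symmetric] cube_fourier_Plancherel l2_norm_def L2_set_square)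
  finally show ?thesis
    by (subst (asm) L2_set_le_iff) (auto simp: D_def l2_norm_def)
qed

text \<open>For every \<omega> the restricted functions obey \<open>Lepingle\<close> with one
  constant. Minkowski's inequality, for the r-variation and then in L^2, takes the average over
  \<omega> outside, with the same \<open>\<kappa>\<close> for every \<omega>.\<close>

lemma smooth_osc_bound:
  assumes r: "2 < r" and n: "1 \<le> n"
    and \<kappa>: "\<And>x. x \<in> hypercube n \<Longrightarrow> mono (\<kappa> x)" "\<And>x. x \<in> hypercube n \<Longrightarrow> \<kappa> x (J x) \<le> n"
  shows "L2_set (\<lambda>x. osc r (\<lambda>k. fourier_mult n (\<lambda>y. (1 - real k / n) ^ weight n y) f x) (\<kappa> x) (J x)) (hypercube n)
    \<le> sqrt ((64 * 4 powr (r - 2)) powr (2 / r) * (4 + 1 / (1 - (1 / 2) powr (r - 2)))) * l2_norm n f"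
proof -
  let ?Q = "hypercube n"
  define \<Omega> where "\<Omega> = ({1..n} \<rightarrow>\<^sub>E {..<n})"
  define C where "C = (64 * 4 powr (r - 2)) powr (2 / r) * (4 + 1 / (1 - (1 / 2) powr (r - 2)))"
  define F where "F \<omega> k = fourier_mult n (supp_ind n {j. k \<le> \<omega> j}) f" for \<omega> :: "nat \<Rightarrow> nat" and k
  have fin: "finite \<Omega>" by (simp add: \<Omega>_def finite_PiE)
  have card: "card \<Omega> = n ^ n" by (simp add: \<Omega>_def card_PiE)
  have C: "0 \<le> C"
    using r powr_less_mono2[of "r - 2" "1 / 2" 1] by (simp add: C_def)
  have each: "L2_set (\<lambda>x. osc r (\<lambda>k. F \<omega> k x) (\<kappa> x) (J x)) ?Q \<le> sqrt C * l2_norm n f" for \<omega>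
  proof -
    interpret finite_martingale ?Q "\<lambda>t x y. \<forall>j\<in>{1..n}. n - t \<le> \<omega> j \<longrightarrow> x j = y j"
      "\<lambda>t. fourier_mult n (supp_ind n {j. n - t \<le> \<omega> j}) f" n
      by (rule restriction_martingale)
    \<comment> \<open>Martingale time is n minus the radius, so the sampling order is reversed to
      make the sequence of times nondecreasing again.\<close>
    define \<kappa>' where "\<kappa>' x j = n - \<kappa> x (J x - j)" for x j
    have eq: "osc r (\<lambda>k. F \<omega> k x) (\<kappa> x) (J x) = osc r (\<lambda>t. F \<omega> (n - t) x) (\<kappa>' x) (J x)"
      if x: "x \<in> ?Q" for x
    proof -
      have "osc r (\<lambda>k. F \<omega> k x) (\<kappa> x) (J x) = osc r (\<lambda>k. F \<omega> (n - (n - k)) x) (\<kappa> x) (J x)"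
      proof (rule osc_cong)
        fix j assume "j \<le> J x"
        then have "\<kappa> x j \<le> n" using \<kappa>(1)[OF x] \<kappa>(2)[OF x] by (meson le_trans monoD)
        then show "F \<omega> (\<kappa> x j) x = F \<omega> (n - (n - \<kappa> x j)) x" by simp
      qed
      also have "\<dots> = osc r (\<lambda>t. F \<omega> (n - t) x) (\<lambda>j. n - \<kappa> x j) (J x)"
        by (rule osc_comp)
      also have "\<dots> = osc r (\<lambda>t. F \<omega> (n - t) x) (\<kappa>' x) (J x)"
        unfolding \<kappa>'_def by (rule osc_reverse)
      finally show ?thesis .
    qed
    have mono: "mono (\<kappa>' x)" if "x \<in> ?Q" for x
      unfolding \<kappa>'_def using \<kappa>(1)[OF that] by (auto intro!: monoI diff_le_mono2 dest: monoD)
    \<comment> \<open>At time n the threshold is 0, no frequency is removed, and the terminal value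
      is f itself.\<close>
    have "supp_ind n {j. n - n \<le> \<omega> j} = (\<lambda>y. 1)" by (simp add: supp_ind_def fun_eq_iff)
    then have "(\<Sum>x\<in>?Q. (norm (fourier_mult n (supp_ind n {j. n - n \<le> \<omega> j}) f x))\<^sup>2) = (l2_norm n f)\<^sup>2"
      by (simp only: l2_norm_def L2_set_square fourier_mult_one cong: sum.cong)
    with Lepingle[OF r mono, where J = J] have
      "(\<Sum>x\<in>?Q. (osc r (\<lambda>t. F \<omega> (n - t) x) (\<kappa>' x) (J x))\<^sup>2) \<le> C * (l2_norm n f)\<^sup>2"
      by (simp only: F_def C_def) (simp add: \<kappa>'_def)
    then have "L2_set (\<lambda>x. osc r (\<lambda>t. F \<omega> (n - t) x) (\<kappa>' x) (J x)) ?Q \<le> sqrt C * l2_norm n f"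
      using C by (subst (asm) L2_set_le_iff) (auto simp: l2_norm_def)
    then show ?thesis by (simp add: eq cong: L2_set_cong_simp)
  qed
  let ?c = "1 / real n ^ n"
  have "L2_set (\<lambda>x. osc r (\<lambda>k. fourier_mult n (\<lambda>y. (1 - real k / n) ^ weight n y) f x) (\<kappa> x) (J x)) ?Q
    \<le> L2_set (\<lambda>x. \<Sum>\<omega>\<in>\<Omega>. ?c * osc r (\<lambda>k. F \<omega> k x) (\<kappa> x) (J x)) ?Q"
  proof (rule L2_set_mono)
    fix x assume x: "x \<in> ?Q"
    have "osc r (\<lambda>k. fourier_mult n (\<lambda>y. (1 - real k / n) ^ weight n y) f x) (\<kappa> x) (J x)
      = osc r (\<lambda>k. \<Sum>\<omega>\<in>\<Omega>. complex_of_real ?c * F \<omega> k x) (\<kappa> x) (J x)"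
    proof (rule osc_cong)
      fix j assume "j \<le> J x"
      then have "\<kappa> x j \<le> n" using \<kappa>(1)[OF x] \<kappa>(2)[OF x] by (meson le_trans monoD)
      then show "fourier_mult n (\<lambda>y. (1 - real (\<kappa> x j) / n) ^ weight n y) f x
         = (\<Sum>\<omega>\<in>\<Omega>. complex_of_real ?c * F \<omega> (\<kappa> x j) x)"
        unfolding F_def \<Omega>_def by (rule smooth_mult_average[OF n])
    qed
    also have "\<dots> \<le> (\<Sum>\<omega>\<in>\<Omega>. osc r (\<lambda>k. complex_of_real ?c * F \<omega> k x) (\<kappa> x) (J x))"
      using r fin by (intro osc_sum) auto
    also have "\<dots> = (\<Sum>\<omega>\<in>\<Omega>. ?c * osc r (\<lambda>k. F \<omega> k x) (\<kappa> x) (J x))"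
      using r by (simp only: osc_mult norm_of_real) simp
    finally show "osc r (\<lambda>k. fourier_mult n (\<lambda>y. (1 - real k / n) ^ weight n y) f x) (\<kappa> x) (J x)
      \<le> (\<Sum>\<omega>\<in>\<Omega>. ?c * osc r (\<lambda>k. F \<omega> k x) (\<kappa> x) (J x))" .
  qed simp
  also have "\<dots> \<le> (\<Sum>\<omega>\<in>\<Omega>. L2_set (\<lambda>x. ?c * osc r (\<lambda>k. F \<omega> k x) (\<kappa> x) (J x)) ?Q)"
    by (rule L2_set_sum_le[OF fin])
  also have "\<dots> = (\<Sum>\<omega>\<in>\<Omega>. ?c * L2_set (\<lambda>x. osc r (\<lambda>k. F \<omega> k x) (\<kappa> x) (J x)) ?Q)"
    by (intro sum.cong refl L2_set_right_distrib[symmetric]) simp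
  also have "\<dots> \<le> (\<Sum>\<omega>\<in>\<Omega>. ?c * (sqrt C * l2_norm n f))"
    by (intro sum_mono mult_left_mono each) auto
  also have "\<dots> = sqrt C * l2_norm n f" using n by (simp add: card)
  finally show ?thesis by (simp only: C_def)
qed

definition osc_constant :: "real \<Rightarrow> real" where
  "osc_constant r = sqrt 72000 +
     sqrt ((64 * 4 powr (r - 2)) powr (2 / r) * (4 + 1 / (1 - (1 / 2) powr (r - 2))))"

lemma spherical_osc_bound_half:
  assumes r: "2 < r" and n: "1 \<le> n" "2 * h \<le> n"
    and f: "\<And>y. y \<in> high_freqs n \<Longrightarrow> cube_fourier n f y = 0"
    and \<kappa>: "\<And>x. x \<in> hypercube n \<Longrightarrow> mono (\<kappa> x)" "\<And>x. x \<in> hypercube n \<Longrightarrow> \<kappa> x (J x) \<le> h"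
  shows "L2_set (\<lambda>x. osc r (\<lambda>k. spherical_mean n k f x) (\<kappa> x) (J x)) (hypercube n)
    \<le> osc_constant r * l2_norm n f"
proof -
  have split: "spherical_mean n k f x = fourier_mult n (\<lambda>y. mult_diff n k (weight n y)) f x
     + fourier_mult n (\<lambda>y. (1 - real k / n) ^ weight n y) f x" if "x \<in> hypercube n" for k x
    unfolding spherical_mean_mult[OF that] fourier_mult_add[symmetric] by (simp add: mult_diff_def)
  have "\<kappa> x (J x) \<le> n" if "x \<in> hypercube n" for x using \<kappa>(2)[OF that] n by simp
  note smooth = smooth_osc_bound[OF r n(1) \<kappa>(1) this]
  have "L2_set (\<lambda>x. osc r (\<lambda>k. spherical_mean n k f x) (\<kappa> x) (J x)) (hypercube n) \<le>
    L2_set (\<lambda>x. osc r (\<lambda>k. fourier_mult n (\<lambda>y. mult_diff n k (weight n y)) f x) (\<kappa> x) (J x)) (hypercube n)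
    + L2_set (\<lambda>x. osc r (\<lambda>k. fourier_mult n (\<lambda>y. (1 - real k / n) ^ weight n y) f x) (\<kappa> x) (J x)) (hypercube n)"
    using r by (intro L2_set_le_add) (auto simp: split intro: osc_add)
  also have "\<dots> \<le> osc_constant r * l2_norm n f"
    unfolding osc_constant_def distrib_right
    using r by (intro add_mono smooth difference_osc_bound[where h = h] n f \<kappa>) auto
  finally show ?thesis .
qed

section \<open>Antipodal symmetry and the passage to all radii\<close>

definition antipode :: "nat \<Rightarrow> (nat \<Rightarrow> nat) \<Rightarrow> nat \<Rightarrow> nat" where
  "antipode n x = (\<lambda>j\<in>{1..n}. 1 - x j)"

lemma antipode_hypercube: "antipode n x \<in> hypercube n"
  by (auto simp: antipode_def hypercube_def)

lemma antipode_antipode: "x \<in> hypercube n \<Longrightarrow> antipode n (antipode n x) = x"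
  by (rule hypercube_eqI[OF antipode_hypercube]) (auto simp: antipode_def dest: hypercube_coord)

lemma hamming_dist_antipode:
  assumes "x \<in> hypercube n" "y \<in> hypercube n"
  shows "hamming_dist n (antipode n x) y = n - hamming_dist n x y"
proof -
  let ?B = "{j \<in> {1..n}. x j \<noteq> y j}"
  have "{j \<in> {1..n}. antipode n x j \<noteq> y j} = {1..n} - ?B"
  proof -
    have "antipode n x j \<noteq> y j \<longleftrightarrow> x j = y j" if "j \<in> {1..n}" for j
      using hypercube_coord[OF assms(1) that] hypercube_coord[OF assms(2) that] that
      by (auto simp: antipode_def)
    then show ?thesis by (intro set_eqI) (simp only: mem_Collect_eq Diff_iff, blast)
  qed
  moreover have "card ({1..n} - ?B) = card {1..n} - card ?B" by (rule card_Diff_subset) auto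
  ultimately show ?thesis by (simp only: hamming_dist_def card_atLeastAtMost diff_Suc_1)
qed

lemma hamming_dist_le: "hamming_dist n x y \<le> n"
  unfolding hamming_dist_def by (rule order_trans[OF card_mono[of "{1..n}"]]) auto

lemma spherical_mean_antipode:
  assumes "x \<in> hypercube n" "k \<le> n"
  shows "spherical_mean n (n - k) f x = spherical_mean n k f (antipode n x)"
proof -
  have "{y. y \<in> hypercube n \<and> hamming_dist n x y = n - k}
    = {y. y \<in> hypercube n \<and> hamming_dist n (antipode n x) y = k}"
  proof (intro Collect_cong conj_cong refl)
    fix y assume "y \<in> hypercube n"
    then show "hamming_dist n x y = n - k \<longleftrightarrow> hamming_dist n (antipode n x) y = k"
      using hamming_dist_antipode[OF assms(1)] hamming_dist_le[of n x y] assms(2) by auto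
  qed
  moreover have "n choose (n - k) = n choose k" using assms(2) by (rule binomial_symmetric[symmetric])
  ultimately show ?thesis by (simp add: spherical_mean_def)
qed

lemma L2_set_antipode:
  "L2_set (\<lambda>x. g (antipode n x)) (hypercube n) = L2_set g (hypercube n)"
  unfolding L2_set_def
  by (intro arg_cong[of _ _ sqrt] sum.reindex_bij_witness[where i = "antipode n" and j = "antipode n"])
    (auto simp: antipode_hypercube antipode_antipode)

text \<open>Controls S_h f at the middle radius, which enters \<open>osc_split_half\<close> as the
  cost of passing from one half of the radii to the other.\<close>

lemma spherical_l2_bound:
  assumes n: "1 \<le> n" "2 * k \<le> n"
    and f: "\<And>y. y \<in> high_freqs n \<Longrightarrow> cube_fourier n f y = 0"
  shows "L2_set (\<lambda>x. norm (spherical_mean n k f x)) (hypercube n) \<le> l2_norm n f"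
proof -
  have "(\<Sum>x\<in>hypercube n. (norm (spherical_mean n k f x))\<^sup>2)
      = (\<Sum>y\<in>hypercube n. (kraw n k (weight n y))\<^sup>2 * (norm (cube_fourier n f y))\<^sup>2)"
    by (simp add: spherical_mean_mult fourier_mult_Plancherel)
  also have "\<dots> \<le> (\<Sum>y\<in>hypercube n. (norm (cube_fourier n f y))\<^sup>2)"
  proof (rule sum_mono)
    fix y assume y: "y \<in> hypercube n"
    show "(kraw n k (weight n y))\<^sup>2 * (norm (cube_fourier n f y))\<^sup>2 \<le> (norm (cube_fourier n f y))\<^sup>2"
    proof (cases "y \<in> high_freqs n")
      case True
      then show ?thesis using f by simp
    next
      case False
      then have "2 * weight n y \<le> n" using y by (auto simp: high_freqs_def)
      then have "\<bar>kraw n k (weight n y)\<bar> \<le> exp (- (real (weight n y) * real k / (5 * real n)))"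
        using n by (intro kraw_exp_bound)
      also have "\<dots> \<le> 1" by simp
      finally have "(kraw n k (weight n y))\<^sup>2 \<le> 1" by (simp add: abs_square_le_1)
      then show ?thesis by (simp add: mult_left_le_one_le)
    qed
  qed
  finally show ?thesis
    by (simp add: cube_fourier_Plancherel l2_norm_def L2_set_def)
qed

lemma osc_split_half:
  assumes r: "1 \<le> r" and h: "h = n div 2" and x: "x \<in> hypercube n"
    and \<kappa>: "mono \<kappa>" "\<kappa> J \<le> n"
  shows "osc r (\<lambda>k. spherical_mean n k f x) \<kappa> J \<le>
    osc r (\<lambda>k. spherical_mean n k f x) (\<lambda>j. min (\<kappa> j) h) J
    + osc r (\<lambda>k. spherical_mean n k f (antipode n x)) (\<lambda>j. min (n - \<kappa> (J - j)) h) J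
    + (norm (spherical_mean n h f x) + norm (spherical_mean n h f (antipode n x)))"
proof -
  define a b where "a k = spherical_mean n k f x" and "b k = spherical_mean n k f (antipode n x)" for k
  have ab: "a (n - k) = b k" if "k \<le> n" for k
    using spherical_mean_antipode[OF x that] by (simp add: a_def b_def)
  define e where "e k = (if k \<le> h then 0 else b h - a h)" for k
  have m: "\<kappa> i \<le> \<kappa> j" if "i \<le> j" for i j using \<kappa>(1) that by (rule monoD)
  have "osc r a \<kappa> J = osc r (\<lambda>k. a (min k h) + (b (min (n - k) h) + (e k + (- b h)))) \<kappa> J"
  proof (rule osc_cong)
    fix j assume "j \<le> J"
    then have k: "\<kappa> j \<le> n" using m[of j J] \<kappa>(2) by simp
    show "a (\<kappa> j) = a (min (\<kappa> j) h) + (b (min (n - \<kappa> j) h) + (e (\<kappa> j) + (- b h)))"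
    proof (cases "\<kappa> j \<le> h")
      case True
      then have "min (n - \<kappa> j) h = h" using h by simp
      then show ?thesis using True by (simp add: e_def)
    next
      case False
      \<comment> \<open>For odd n as well, k > n div 2 implies n - k \<le> n div 2.\<close>
      then have "min (n - \<kappa> j) h = n - \<kappa> j" using h by simp
      moreover have "b (n - \<kappa> j) = a (\<kappa> j)" using ab[of "n - \<kappa> j"] k by simp
      ultimately show ?thesis using False by (simp add: e_def)
    qed
  qed
  also have "\<dots> \<le> osc r (\<lambda>k. a (min k h)) \<kappa> J + (osc r (\<lambda>k. b (min (n - k) h)) \<kappa> J
      + (osc r e \<kappa> J + osc r (\<lambda>k. - b h) \<kappa> J))"
    by (intro order_trans[OF osc_add[OF r]] add_left_mono osc_add r order_refl)
  also have "osc r (\<lambda>k. a (min k h)) \<kappa> J = osc r a (\<lambda>j. min (\<kappa> j) h) J" by (rule osc_comp)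
  also have "osc r (\<lambda>k. b (min (n - k) h)) \<kappa> J = osc r b (\<lambda>j. min (n - \<kappa> (J - j)) h) J"
    unfolding osc_comp[of r b "\<lambda>k. min (n - k) h"] by (rule osc_reverse)
  also have "osc r e \<kappa> J \<le> norm (a h) + norm (b h)"
  proof -
    have "osc r e \<kappa> J \<le> (\<Sum>j<J. norm (e (\<kappa> (Suc j)) - e (\<kappa> j)))" by (rule osc_le_sum_norm[OF r])
    also have "\<dots> = (\<Sum>j<J. norm (b h - a h) * (of_bool (h < \<kappa> (Suc j)) - of_bool (h < \<kappa> j)))"
    proof (rule sum.cong[OF refl])
      fix j
      show "norm (e (\<kappa> (Suc j)) - e (\<kappa> j)) = norm (b h - a h) * (of_bool (h < \<kappa> (Suc j)) - of_bool (h < \<kappa> j))"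
        using m[of j "Suc j"] by (auto simp: e_def)
    qed
    also have "\<dots> = norm (b h - a h) * (of_bool (h < \<kappa> J) - of_bool (h < \<kappa> 0))"
      unfolding sum_distrib_left[symmetric]
      by (subst sum_lessThan_telescope[where f = "\<lambda>j. of_bool (h < \<kappa> j)"]) simp
    also have "\<dots> \<le> norm (b h - a h) * 1" by (intro mult_left_mono) auto
    also have "\<dots> \<le> norm (a h) + norm (b h)" using norm_triangle_ineq4[of "b h" "a h"] by simp
    finally show ?thesis .
  qed
  finally show ?thesis by (simp add: a_def b_def)
qed

lemma spherical_osc_bound:
  assumes r: "2 < r" and n: "1 \<le> n"
    and f: "\<And>y. y \<in> high_freqs n \<Longrightarrow> cube_fourier n f y = 0"
    and \<kappa>: "\<And>x. x \<in> hypercube n \<Longrightarrow> mono (\<kappa> x)" "\<And>x. x \<in> hypercube n \<Longrightarrow> \<kappa> x (J x) \<le> n"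
  shows "L2_set (\<lambda>x. osc r (\<lambda>k. spherical_mean n k f x) (\<kappa> x) (J x)) (hypercube n)
    \<le> (2 * osc_constant r + 2) * l2_norm n f"
proof -
  let ?Q = "hypercube n"
  define h where "h = n div 2"
  have h: "2 * h \<le> n" by (simp add: h_def)
  define S where "S k x = spherical_mean n k f x" for k x
  define A where "A x = osc r (\<lambda>k. S k x) (\<lambda>j. min (\<kappa> x j) h) (J x)" for x
  define B where "B x = osc r (\<lambda>k. S k (antipode n x)) (\<lambda>j. min (n - \<kappa> x (J x - j)) h) (J x)" for x
  \<comment> \<open>\<open>B\<close> takes means at the antipode along the sequence attached to x;
    substituting the antipode gives \<open>B'\<close>, with means at x along the sequence attached
    to the antipode. The dependence of \<open>\<kappa>\<close> on x is arbitrary in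
    \<open>spherical_osc_bound_half\<close>, which therefore covers it.\<close>
  define B' where "B' x = osc r (\<lambda>k. S k x)
    (\<lambda>j. min (n - \<kappa> (antipode n x) (J (antipode n x) - j)) h) (J (antipode n x))" for x
  have "L2_set (\<lambda>x. osc r (\<lambda>k. S k x) (\<kappa> x) (J x)) ?Q \<le>
     L2_set (\<lambda>x. A x + B x) ?Q + L2_set (\<lambda>x. norm (S h x) + norm (S h (antipode n x))) ?Q"
    unfolding A_def B_def S_def using r \<kappa>
    by (intro L2_set_le_add osc_split_half h_def osc_nonneg) auto
  also have "\<dots> \<le> (L2_set A ?Q + L2_set B ?Q)
      + (L2_set (\<lambda>x. norm (S h x)) ?Q + L2_set (\<lambda>x. norm (S h (antipode n x))) ?Q)"
    by (intro add_mono L2_set_triangle_ineq)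
  also have "L2_set A ?Q \<le> osc_constant r * l2_norm n f"
    unfolding A_def S_def
  proof (rule spherical_osc_bound_half[OF r n h f])
    fix x assume "x \<in> ?Q"
    then show "mono (\<lambda>j. min (\<kappa> x j) h)" using \<kappa>(1) by (fastforce intro!: monoI dest: monoD)
  qed auto
  also have "L2_set B ?Q = L2_set B' ?Q"
  proof -
    have "L2_set B ?Q = L2_set (\<lambda>x. B' (antipode n x)) ?Q"
      by (intro L2_set_cong refl) (simp add: B_def B'_def antipode_antipode)
    then show ?thesis by (simp add: L2_set_antipode)
  qed
  also have "L2_set B' ?Q \<le> osc_constant r * l2_norm n f"
    unfolding B'_def S_def
  proof (rule spherical_osc_bound_half[OF r n h f])
    fix x assume "x \<in> ?Q"
    have "\<kappa> (antipode n x) (J (antipode n x) - j) \<le> \<kappa> (antipode n x) (J (antipode n x) - i)" if "i \<le> j" for i j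
      by (rule monoD[OF \<kappa>(1)[OF antipode_hypercube]]) (use that in simp)
    then show "mono (\<lambda>j. min (n - \<kappa> (antipode n x) (J (antipode n x) - j)) h)"
      by (intro monoI min.mono diff_le_mono2 order_refl)
  qed auto
  also have "L2_set (\<lambda>x. norm (S h x)) ?Q \<le> l2_norm n f"
    unfolding S_def by (rule spherical_l2_bound[OF n h f])
  also have "L2_set (\<lambda>x. norm (S h (antipode n x))) ?Q = L2_set (\<lambda>x. norm (S h x)) ?Q"
    by (rule L2_set_antipode)
  also have "\<dots> \<le> l2_norm n f"
    unfolding S_def by (rule spherical_l2_bound[OF n h f])
  finally show ?thesis by (simp add: S_def algebra_simps)
qed

section \<open>Reduction of the variation to sampling sequences\<close>

lemma variation_eq_osc:
  "\<exists>\<kappa> J. variation r {0..n} a = osc r a \<kappa> J \<and> mono \<kappa> \<and> \<kappa> J \<le> n"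
proof -
  let ?v = "\<lambda>ks. (\<Sum>j = 1..length ks - 1. norm (a (ks ! (j - 1)) - a (ks ! j)) powr r) powr (1 / r)"
  have "Max (?v ` increasing_seqs {0..n}) \<in> ?v ` increasing_seqs {0..n}"
    using finite_increasing_seqs[of "{0..n}"] increasing_seqs_nonempty[of 0 "{0..n}"]
    by (intro Max_in) auto
  then obtain ks where ks: "ks \<in> increasing_seqs {0..n}" "variation r {0..n} a = ?v ks"
    by (auto simp: variation_def)
  define J where "J = length ks - 1"
  \<comment> \<open>The maximising list, continued past its end by its last entry so as to be
    monotone on all of \<open>nat\<close>.\<close>
  define \<kappa> where "\<kappa> j = ks ! min j J" for j
  have ne: "ks \<noteq> []" and srt: "sorted_wrt (<) ks" and sub: "set ks \<subseteq> {0..n}"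
    using ks(1) by (auto simp: increasing_seqs_def)
  have J: "J < length ks" using ne by (simp add: J_def)
  have "mono \<kappa>"
  proof (rule monoI)
    fix i j :: nat assume "i \<le> j"
    then have "min i J \<le> min j J" "min j J < length ks" using J by auto
    then show "\<kappa> i \<le> \<kappa> j"
      using srt unfolding \<kappa>_def by (metis le_less sorted_wrt_nth_less order_refl)
  qed
  moreover have "\<kappa> J \<le> n" using subsetD[OF sub nth_mem[OF J]] by (simp add: \<kappa>_def)
  moreover have "?v ks = osc r a \<kappa> J"
  proof -
    have "(\<Sum>j = 1..J. norm (a (ks ! (j - 1)) - a (ks ! j)) powr r)
      = (\<Sum>j<J. norm (a (ks ! j) - a (ks ! Suc j)) powr r)"
      by (rule sum.reindex_bij_witness[where i = Suc and j = "\<lambda>j. j - 1"]) auto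
    also have "\<dots> = (\<Sum>j<J. norm (a (\<kappa> (Suc j)) - a (\<kappa> j)) powr r)"
      by (intro sum.cong) (auto simp: \<kappa>_def norm_minus_commute min_def)
    finally show ?thesis by (simp add: osc_def J_def)
  qed
  ultimately show ?thesis using ks(2) by auto
qed

theorem proposition1p2:
  fixes r :: real
  assumes "r > 2"
  shows "(SUP n\<in>{n::nat. n \<ge> 1}.
            SUP f\<in>{f \<in> hypercube n \<rightarrow>\<^sub>E (UNIV :: complex set).
                    (\<exists>x\<in>hypercube n. f x \<noteq> 0) \<and>
                    (\<forall>y\<in>high_freqs n. cube_fourier n f y = 0)}.
              ereal (l2_norm n (\<lambda>x. variation r {0..n} (\<lambda>k. spherical_mean n k f x))
                     / l2_norm n f)) < \<infinity>"
proof -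
  let ?C = "2 * osc_constant r + 2"
  have "l2_norm n (\<lambda>x. variation r {0..n} (\<lambda>k. spherical_mean n k f x)) / l2_norm n f \<le> ?C"
    if n: "1 \<le> n" and f: "\<exists>x\<in>hypercube n. f x \<noteq> 0" "\<forall>y\<in>high_freqs n. cube_fourier n f y = 0" for n f
  proof -
    \<comment> \<open>Choosing a maximising sequence at every point replaces the maximum by sampling
      along point-dependent sequences.\<close>
    obtain \<kappa> J where \<kappa>: "\<And>x. variation r {0..n} (\<lambda>k. spherical_mean n k f x)
          = osc r (\<lambda>k. spherical_mean n k f x) (\<kappa> x) (J x)"
        "\<And>x. mono (\<kappa> x)" "\<And>x. \<kappa> x (J x) \<le> n"
      using variation_eq_osc[of r n "\<lambda>k. spherical_mean n k f x" for x] by metis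
    have "l2_norm n (\<lambda>x. variation r {0..n} (\<lambda>k. spherical_mean n k f x)) \<le> ?C * l2_norm n f"
      using spherical_osc_bound[of r n f \<kappa> J] assms n f(2) \<kappa>(2,3)
      by (simp add: \<kappa>(1) l2_norm_def)
    moreover have "l2_norm n f > 0"
    proof -
      have "l2_norm n f \<noteq> 0" using f(1) by (simp add: l2_norm_def L2_set_eq_0_iff)
      then show ?thesis by (simp add: l2_norm_def less_le)
    qed
    ultimately show ?thesis by (simp add: divide_le_eq)
  qed
  then have "(SUP n\<in>{n::nat. n \<ge> 1}.
            SUP f\<in>{f \<in> hypercube n \<rightarrow>\<^sub>E (UNIV :: complex set).
                    (\<exists>x\<in>hypercube n. f x \<noteq> 0) \<and>
                    (\<forall>y\<in>high_freqs n. cube_fourier n f y = 0)}.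
              ereal (l2_norm n (\<lambda>x. variation r {0..n} (\<lambda>k. spherical_mean n k f x))
                     / l2_norm n f)) \<le> ereal ?C"
    by (intro SUP_least) auto
  then show ?thesis by (rule order.strict_trans1) simp
qed

end
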